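(* Let $N\ge 2$, $p>1$ and $f\in L^1(\partial B_2)$, where $\partial B_2=\{x\in\mathbb{R}^N:|x|=2\}$. Suppose that $$\int_{\partial B_2} f(x)\,d\sigma>0\qquad\text{and}\qquad p=\rho-1 .$$ Let $A=\{x\in\mathbb{R}^N:1<|x|\le 2\}$. Then: (i) the parabolic inequality $$u_t-\Delta u\ge (|x|-1)^{-\rho}|u|^p\quad\text{in }(0,\infty)\times A,$$ under either the Neumann-type boundary condition $\frac{\partial u}{\partial\nu}(t,x)\ge f(x)$ on $(0,\infty)\times\partial B_2$ or the Dirichlet-type boundary condition $u(t,x)\ge f(x)$ on $(0,\infty)\times\partial B_2$, does not admit global weak solutions; (ii) the hyperbolic inequality $$u_{tt}-\Delta u\ge (|x|-1)^{-\rho}|u|^p\quad\text{in }(0,\infty)\times A,$$ under either the Neumann-type boundary condition $\frac{\partial u}{\partial\nu}(t,x)\ge f(x)$ on $(0,\infty)\times\partial B_2$ or the Dirichlet-type boundary condition $u(t,x)\ge f(x)$ on $(0,\infty)\times\partial B_2$, does not admit global weak solutions.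
   Context: Notation: $A=\{x\in\mathbb{R}^N:1<|x|\le2\}$ (the outer sphere $|x|=2$ belongs to $A$, the inner sphere $|x|=1$ does not); for $T\in(0,\infty]$, $Q_T=(0,T)\times A$ and $\Gamma=(0,T)\times\partial B_2$; $\nu$ is the outward unit normal on $\partial B_2$ relative to $A$; $d\sigma$ is the surface measure on $\partial B_2$. $L^p_{\rm loc}(Q_T)$ and $C^2_c(Q_T)$ refer to compact subsets of $Q_T$; these may touch $|x|=2$ but not $|x|=1$. No initial conditions are imposed. Test functions. Neumann class: all $\varphi\in C^2_c(Q_T)$ with $\varphi\ge0$, $\varphi(T,\cdot)=0$ (automatic from compact support when $T=\infty$) and $\frac{\partial\varphi}{\partial\nu}=0$ on $\Gamma$. Dirichlet class: all $\psi\in C^2_c(Q_T)$ with $\psi\ge0$, $\psi(T,\cdot)=0$ (automatic when $T=\infty$), $\psi=0$ on $\Gamma$ and $\frac{\partial\psi}{\partial\nu}\le0$ on $\Gamma$. Weak solutions. A function $u\in L^p_{\rm loc}(Q_T)$ is a weak solution of: - the parabolic Neumann problem if, for all $\varphi$ in the Neumann class, $$\int_{Q_T}(|x|-1)^{-\rho}|u|^p\varphi\,dx\,dt+\int_\Gamma f\varphi\,d\sigma\,dt\le-\int_{Q_T}u\varphi_t\,dx\,dt-\int_{Q_T}u\Delta\varphi\,dx\,dt;$$ - the parabolic Dirichlet problem if, for all $\psi$ in the Dirichlet class, $$\int_{Q_T}(|x|-1)^{-\rho}|u|^p\psi\,dx\,dt-\int_\Gamma f\frac{\partial\psi}{\partial\nu}\,d\sigma\,dt\le-\int_{Q_T}u\psi_t\,dx\,dt-\int_{Q_T}u\Delta\psi\,dx\,dt;$$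 - the hyperbolic Neumann problem if, for all $\varphi$ in the Neumann class, $$\int_{Q_T}(|x|-1)^{-\rho}|u|^p\varphi\,dx\,dt+\int_\Gamma f\varphi\,d\sigma\,dt\le\int_{Q_T}u\varphi_{tt}\,dx\,dt-\int_{Q_T}u\Delta\varphi\,dx\,dt;$$ - the hyperbolic Dirichlet problem if, for all $\psi$ in the Dirichlet class, $$\int_{Q_T}(|x|-1)^{-\rho}|u|^p\psi\,dx\,dt-\int_\Gamma f\frac{\partial\psi}{\partial\nu}\,d\sigma\,dt\le\int_{Q_T}u\psi_{tt}\,dx\,dt-\int_{Q_T}u\Delta\psi\,dx\,dt.$$ A weak solution is called global (in time) if $T=+\infty$. *)

theory Defs
  imports "HOL-Analysis.Analysis"
begin

definition shell :: "'a::euclidean_space set" where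
  "shell = {x. 1 < norm x \<and> norm x \<le> 2}"

definition cylinder :: "ereal \<Rightarrow> (real \<times> 'a::euclidean_space) set" where
  "cylinder T = {(t, x). 0 < t \<and> ereal t < T \<and> x \<in> shell}"

definition lateral :: "ereal \<Rightarrow> (real \<times> 'a::euclidean_space) set" where
  "lateral T = {(t, x). 0 < t \<and> ereal t < T \<and> x \<in> sphere 0 2}"

text \<open>Surface measure on the sphere of radius \<open>R\<close> about the origin, as in integration in
  polar coordinates: \<open>\<sigma>(E)\<close> is \<open>N / R\<close> times the volume of the open cone
  \<open>{s x | 0 < s < 1, x \<in> E}\<close> (see the lemma below). The measure is completed, so that
  integrability does not require Borel measurability.\<close>

definition surface_measure :: "real \<Rightarrow> 'a::euclidean_space measure" where
  "surface_measure R = completion (scale_measure (ennreal (real DIM('a) / R))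
     (distr (restrict_space lborel (ball 0 R - {0})) (restrict_space borel (sphere 0 R))
       (\<lambda>x. (R / norm x) *\<^sub>R x)))"

lemma space_surface_measure: "space (surface_measure R) = sphere 0 R"
  by (simp add: surface_measure_def space_restrict_space space_scale_measure)

lemma emeasure_surface_measure:
  fixes E :: "'a::euclidean_space set"
  assumes R: "R > 0" and E: "E \<in> sets borel" "E \<subseteq> sphere 0 R"
  shows "emeasure (surface_measure R) E
    = ennreal (real DIM('a) / R) * emeasure lborel {s *\<^sub>R x | s x. 0 < s \<and> s < 1 \<and> x \<in> E}"
proof -
  let ?h = "\<lambda>x::'a. (R / norm x) *\<^sub>R x"
  let ?M = "restrict_space lborel (ball (0::'a) R - {0})"
  let ?S = "restrict_space borel (sphere (0::'a) R)"
  have h: "?h \<in> measurable ?M ?S"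
  proof (rule measurable_restrict_space2)
    show "?h \<in> space ?M \<rightarrow> sphere 0 R" using R by (auto simp: space_restrict_space)
    have "?h \<in> borel_measurable borel" by measurable
    then show "?h \<in> borel_measurable ?M"
      by (intro measurable_restrict_space1) simp
  qed
  have ES: "E \<in> sets ?S" using E by (auto simp: sets_restrict_space)
  have eq: "?h -` E \<inter> space ?M = {s *\<^sub>R x | s x. 0 < s \<and> s < 1 \<and> x \<in> E}"
  proof (intro set_eqI iffI)
    fix y assume "y \<in> ?h -` E \<inter> space ?M"
    then have y: "?h y \<in> E" "norm y < R" "y \<noteq> 0" by (auto simp: space_restrict_space)
    then have "y = (norm y / R) *\<^sub>R ?h y" "0 < norm y / R" "norm y / R < 1" using R by auto
    then show "y \<in> {s *\<^sub>R x | s x. 0 < s \<and> s < 1 \<and> x \<in> E}" using y(1) by blast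
  next
    fix y assume "y \<in> {s *\<^sub>R x | s x. 0 < s \<and> s < 1 \<and> x \<in> E}"
    then obtain s x where sx: "y = s *\<^sub>R x" "0 < s" "s < 1" "x \<in> E" by blast
    with E(2) have n: "norm x = R" by auto
    then show "y \<in> ?h -` E \<inter> space ?M" using sx R by (auto simp: space_restrict_space)
  qed
  have "emeasure (surface_measure R) E
      = emeasure (scale_measure (ennreal (real DIM('a) / R)) (distr ?M ?S ?h)) E"
    unfolding surface_measure_def using ES by (simp add: sets_scale_measure)
  also have "\<dots> = ennreal (real DIM('a) / R) * emeasure ?M (?h -` E \<inter> space ?M)"
    using h ES by (simp add: emeasure_distr)
  also have "emeasure ?M (?h -` E \<inter> space ?M) = emeasure lborel (?h -` E \<inter> space ?M)"
    by (intro emeasure_restrict_space) (auto simp: space_restrict_space)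
  finally show ?thesis by (simp only: eq)
qed

definition pderiv_dir :: "'b::real_normed_vector \<Rightarrow> ('b \<Rightarrow> real) \<Rightarrow> 'b \<Rightarrow> real" where
  "pderiv_dir v g z = deriv (\<lambda>s. g (z + s *\<^sub>R v)) 0"

definition C1_on :: "'b::euclidean_space set \<Rightarrow> ('b \<Rightarrow> real) \<Rightarrow> bool" where
  "C1_on U g \<longleftrightarrow> continuous_on U g \<and>
     (\<forall>i\<in>Basis. (\<forall>z\<in>U. (\<lambda>s. g (z + s *\<^sub>R i)) differentiable (at 0)) \<and>
                continuous_on U (pderiv_dir i g))"

definition C2_on :: "'b::euclidean_space set \<Rightarrow> ('b \<Rightarrow> real) \<Rightarrow> bool" where
  "C2_on U g \<longleftrightarrow> C1_on U g \<and> (\<forall>i\<in>Basis. C1_on U (pderiv_dir i g))"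

text \<open>The set \<open>Q\<close> need not be open: a function is \<open>C\<^sup>2\<close> on \<open>Q\<close> if it is the restriction of a
  function that is \<open>C\<^sup>2\<close> on an open neighbourhood of \<open>Q\<close>. Below, \<open>Q\<close> is contained in the
  closure of its interior, so the derivatives on \<open>Q\<close> are determined by the values on \<open>Q\<close>.
  Compactness of the support is likewise relative to \<open>Q\<close>.\<close>

definition C2_compact :: "'b::euclidean_space set \<Rightarrow> ('b \<Rightarrow> real) \<Rightarrow> bool" where
  "C2_compact Q g \<longleftrightarrow> (\<exists>U. open U \<and> Q \<subseteq> U \<and> C2_on U g) \<and>
     (\<exists>K. compact K \<and> K \<subseteq> Q \<and> (\<forall>z\<in>Q - K. g z = 0))"

definition Lp_loc :: "real \<Rightarrow> 'b::euclidean_space set \<Rightarrow> ('b \<Rightarrow> real) \<Rightarrow> bool" where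
  "Lp_loc p Q u \<longleftrightarrow> u \<in> borel_measurable (lebesgue_on Q) \<and>
     (\<forall>K. compact K \<and> K \<subseteq> Q \<longrightarrow> set_integrable lebesgue K (\<lambda>z. \<bar>u z\<bar> powr p))"

definition time_deriv :: "(real \<times> 'a::euclidean_space \<Rightarrow> real) \<Rightarrow> real \<times> 'a \<Rightarrow> real" where
  "time_deriv g = pderiv_dir (1, 0) g"

definition laplacian :: "(real \<times> 'a::euclidean_space \<Rightarrow> real) \<Rightarrow> real \<times> 'a \<Rightarrow> real" where
  "laplacian g z = (\<Sum>i\<in>Basis. pderiv_dir (0, i) (pderiv_dir (0, i) g) z)"

text \<open>The outward unit normal of the shell at a point \<open>x\<close> of the outer sphere is \<open>x / |x|\<close>.\<close>

definition normal_deriv :: "(real \<times> 'a::euclidean_space \<Rightarrow> real) \<Rightarrow> real \<times> 'a \<Rightarrow> real" where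
  "normal_deriv g z = pderiv_dir (0, snd z /\<^sub>R norm (snd z)) g z"

definition neumann_test :: "ereal \<Rightarrow> (real \<times> 'a::euclidean_space \<Rightarrow> real) \<Rightarrow> bool" where
  "neumann_test T \<phi> \<longleftrightarrow> C2_compact (cylinder T) \<phi> \<and>
     (\<forall>z\<in>cylinder T. \<phi> z \<ge> 0) \<and>
     (\<forall>t x. ereal t = T \<and> x \<in> shell \<longrightarrow> \<phi> (t, x) = 0) \<and>
     (\<forall>z\<in>lateral T. normal_deriv \<phi> z = 0)"

definition dirichlet_test :: "ereal \<Rightarrow> (real \<times> 'a::euclidean_space \<Rightarrow> real) \<Rightarrow> bool" where
  "dirichlet_test T \<psi> \<longleftrightarrow> C2_compact (cylinder T) \<psi> \<and>
     (\<forall>z\<in>cylinder T. \<psi> z \<ge> 0) \<and>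
     (\<forall>t x. ereal t = T \<and> x \<in> shell \<longrightarrow> \<psi> (t, x) = 0) \<and>
     (\<forall>z\<in>lateral T. \<psi> z = 0) \<and>
     (\<forall>z\<in>lateral T. normal_deriv \<psi> z \<le> 0)"

definition cyl_integral :: "ereal \<Rightarrow> (real \<times> 'a::euclidean_space \<Rightarrow> real) \<Rightarrow> real" where
  "cyl_integral T g = (LINT z:cylinder T|lebesgue. g z)"

definition lat_integral :: "ereal \<Rightarrow> (real \<times> 'a::euclidean_space \<Rightarrow> real) \<Rightarrow> real" where
  "lat_integral T g = (LINT z:lateral T|(lborel \<Otimes>\<^sub>M surface_measure 2). g z)"

definition source :: "real \<Rightarrow> real \<Rightarrow> (real \<times> 'a::euclidean_space \<Rightarrow> real) \<Rightarrow> real \<times> 'a \<Rightarrow> real" where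
  "source \<rho> p u z = (norm (snd z) - 1) powr (- \<rho>) * \<bar>u z\<bar> powr p"

definition parabolic_neumann_sol ::
  "ereal \<Rightarrow> real \<Rightarrow> real \<Rightarrow> ('a::euclidean_space \<Rightarrow> real) \<Rightarrow> (real \<times> 'a \<Rightarrow> real) \<Rightarrow> bool" where
  "parabolic_neumann_sol T \<rho> p f u \<longleftrightarrow> Lp_loc p (cylinder T) u \<and>
     (\<forall>\<phi>. neumann_test T \<phi> \<longrightarrow>
        cyl_integral T (\<lambda>z. source \<rho> p u z * \<phi> z) + lat_integral T (\<lambda>z. f (snd z) * \<phi> z)
        \<le> - cyl_integral T (\<lambda>z. u z * time_deriv \<phi> z) - cyl_integral T (\<lambda>z. u z * laplacian \<phi> z))"

definition parabolic_dirichlet_sol ::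
  "ereal \<Rightarrow> real \<Rightarrow> real \<Rightarrow> ('a::euclidean_space \<Rightarrow> real) \<Rightarrow> (real \<times> 'a \<Rightarrow> real) \<Rightarrow> bool" where
  "parabolic_dirichlet_sol T \<rho> p f u \<longleftrightarrow> Lp_loc p (cylinder T) u \<and>
     (\<forall>\<psi>. dirichlet_test T \<psi> \<longrightarrow>
        cyl_integral T (\<lambda>z. source \<rho> p u z * \<psi> z) - lat_integral T (\<lambda>z. f (snd z) * normal_deriv \<psi> z)
        \<le> - cyl_integral T (\<lambda>z. u z * time_deriv \<psi> z) - cyl_integral T (\<lambda>z. u z * laplacian \<psi> z))"

definition hyperbolic_neumann_sol ::
  "ereal \<Rightarrow> real \<Rightarrow> real \<Rightarrow> ('a::euclidean_space \<Rightarrow> real) \<Rightarrow> (real \<times> 'a \<Rightarrow> real) \<Rightarrow> bool" where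
  "hyperbolic_neumann_sol T \<rho> p f u \<longleftrightarrow> Lp_loc p (cylinder T) u \<and>
     (\<forall>\<phi>. neumann_test T \<phi> \<longrightarrow>
        cyl_integral T (\<lambda>z. source \<rho> p u z * \<phi> z) + lat_integral T (\<lambda>z. f (snd z) * \<phi> z)
        \<le> cyl_integral T (\<lambda>z. u z * time_deriv (time_deriv \<phi>) z)
          - cyl_integral T (\<lambda>z. u z * laplacian \<phi> z))"

definition hyperbolic_dirichlet_sol ::
  "ereal \<Rightarrow> real \<Rightarrow> real \<Rightarrow> ('a::euclidean_space \<Rightarrow> real) \<Rightarrow> (real \<times> 'a \<Rightarrow> real) \<Rightarrow> bool" where
  "hyperbolic_dirichlet_sol T \<rho> p f u \<longleftrightarrow> Lp_loc p (cylinder T) u \<and>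
     (\<forall>\<psi>. dirichlet_test T \<psi> \<longrightarrow>
        cyl_integral T (\<lambda>z. source \<rho> p u z * \<psi> z) - lat_integral T (\<lambda>z. f (snd z) * normal_deriv \<psi> z)
        \<le> cyl_integral T (\<lambda>z. u z * time_deriv (time_deriv \<psi>) z)
          - cyl_integral T (\<lambda>z. u z * laplacian \<psi> z))"

end

theory Submission
  imports Defs
begin

text \<open>
The proof is by the test function method. Suppose that \<open>u\<close> is a global weak solution, and write
\<open>s = norm x - 1\<close> and \<open>q = p / (p - 1)\<close>. For a test function \<open>\<phi>\<close> the weak formulation has on its
right-hand side the integral of \<open>u * g\<close>, where \<open>g\<close> is the adjoint operator applied to \<open>\<phi>\<close>. Young's
inequality bounds \<open>u * g\<close> by \<open>s powr (- \<rho>) * \<bar>u\<bar> powr p * \<phi>\<close>, which the nonlinear term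
absorbs, plus \<open>k powr q\<close> for any \<open>k\<close> with \<open>\<bar>g\<bar> \<le> (s powr (- \<rho>) * \<phi>) powr (1 / p) * k\<close>. The
solution disappears, and the boundary term is at most the integral of \<open>k powr q\<close>
(\<open>boundary_term_le\<close>).

The test function is \<open>\<phi> (t, x) = \<eta> t * H (norm x) * \<xi> (y (norm x))\<close>. The bump \<open>\<eta>\<close> lives on
\<open>[n, 2 n]\<close> (\<open>time_cutoff_exists\<close>). The weight \<open>H\<close> is radially harmonic: constant for the Neumann
class, and for the Dirichlet class the fundamental solution shifted to vanish on the outer sphere
(\<open>Dirichlet_profile_exists\<close>). In both cases the boundary term is a positive multiple of the integral
of \<open>f\<close> times the integral of \<open>\<eta>\<close>, which is of order \<open>n\<close>. The factor \<open>\<xi>\<close> removes a neighbourhood of the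
inner sphere (\<open>radial_cutoff_exists\<close>).

For \<open>p = \<rho> - 1\<close> a cutoff at a single scale of \<open>s\<close> is not enough: it costs an amount that
does not depend on the scale, the mark of a critical exponent. The cutoff is therefore logarithmic
and spreads over the \<open>n\<close> dyadic rings with \<open>(1/2) ^ (n + 1) \<le> s \<le> 1/2\<close>. The Laplacian of
\<open>\<phi>\<close> gains a factor \<open>1 / n\<close>, the \<open>n\<close> rings contribute equally to the integral of
\<open>1 / s\<close>, and the total cost per unit of time is of order \<open>n powr (1 - q)\<close>, which tends to
\<open>0\<close> (\<open>radial_weak_ineq_imp_nonpos\<close>). The time derivative costs at most a multiple of \<open>n powr (- q)\<close>
per unit of time, for the first as well as for the second derivative, so the parabolic and the
hyperbolic problem are treated together.
\<close>

section \<open>Cutoff functions of one variable\<close>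

text \<open>The derivatives are arguments rather than values of \<open>deriv\<close>, so that the product and chain rules
below return explicit formulas that can be estimated.\<close>
definition second_derivs ::
  "real set \<Rightarrow> (real \<Rightarrow> real) \<Rightarrow> (real \<Rightarrow> real) \<Rightarrow> (real \<Rightarrow> real) \<Rightarrow> bool" where
  "second_derivs D g g1 g2 \<longleftrightarrow> (\<forall>t\<in>D. (g has_real_derivative g1 t) (at t)) \<and>
     (\<forall>t\<in>D. (g1 has_real_derivative g2 t) (at t)) \<and> continuous_on D g2"

lemma second_derivs_continuous:
  assumes "second_derivs D g g1 g2"
  shows "continuous_on D g" "continuous_on D g1" "continuous_on D g2"
  using assms unfolding second_derivs_def
  by (blast intro: DERIV_continuous_on has_field_derivative_at_within)+

lemma second_derivs_mult:
  assumes g: "second_derivs D g g1 g2" and h: "second_derivs D h h1 h2"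
  shows "second_derivs D (\<lambda>t. g t * h t) (\<lambda>t. g1 t * h t + g t * h1 t)
    (\<lambda>t. g2 t * h t + 2 * (g1 t * h1 t) + g t * h2 t)"
  unfolding second_derivs_def
proof (intro conjI ballI)
  fix t assume t: "t \<in> D"
  have d: "(g has_real_derivative g1 t) (at t)" "(g1 has_real_derivative g2 t) (at t)"
    "(h has_real_derivative h1 t) (at t)" "(h1 has_real_derivative h2 t) (at t)"
    using t g h by (auto simp: second_derivs_def)
  show "((\<lambda>t. g t * h t) has_real_derivative g1 t * h t + g t * h1 t) (at t)"
    using DERIV_mult[OF d(1,3)] by (simp add: algebra_simps)
  show "((\<lambda>t. g1 t * h t + g t * h1 t) has_real_derivative
      g2 t * h t + 2 * (g1 t * h1 t) + g t * h2 t) (at t)"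
    using DERIV_add[OF DERIV_mult[OF d(2,3)] DERIV_mult[OF d(1,4)]] by (simp add: algebra_simps)
qed (intro continuous_intros second_derivs_continuous[OF g] second_derivs_continuous[OF h])

lemma second_derivs_compose:
  assumes g: "second_derivs UNIV g g1 g2" and y: "second_derivs D y y1 y2"
  shows "second_derivs D (\<lambda>t. g (y t)) (\<lambda>t. g1 (y t) * y1 t)
    (\<lambda>t. g2 (y t) * (y1 t)\<^sup>2 + g1 (y t) * y2 t)"
  unfolding second_derivs_def
proof (intro conjI ballI)
  fix t assume t: "t \<in> D"
  have d: "(g has_real_derivative g1 (y t)) (at (y t))" "(g1 has_real_derivative g2 (y t)) (at (y t))"
    "(y has_real_derivative y1 t) (at t)" "(y1 has_real_derivative y2 t) (at t)"
    using t g y by (auto simp: second_derivs_def)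
  show "((\<lambda>t. g (y t)) has_real_derivative g1 (y t) * y1 t) (at t)"
    by (rule DERIV_chain2[OF d(1,3)])
  show "((\<lambda>t. g1 (y t) * y1 t) has_real_derivative g2 (y t) * (y1 t)\<^sup>2 + g1 (y t) * y2 t) (at t)"
    using DERIV_mult[OF DERIV_chain2[OF d(2,3)] d(4)]
    by (simp add: algebra_simps power2_eq_square)
qed (intro continuous_intros second_derivs_continuous[OF y]
      continuous_on_compose2[OF second_derivs_continuous(2)[OF g]]
      continuous_on_compose2[OF second_derivs_continuous(3)[OF g]] subset_UNIV)+

text \<open>From the second power on, the corner of the positive part at \<open>0\<close> disappears.\<close>
lemma pos_part_power_has_derivative:
  fixes v :: "real \<Rightarrow> real"
  assumes "(v has_real_derivative d) (at y)"
  shows "((\<lambda>y. max 0 (v y) ^ Suc (Suc k)) has_real_derivative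
           real (Suc (Suc k)) * max 0 (v y) ^ Suc k * d) (at y)"
proof -
  have "((\<lambda>z::real. max 0 z ^ Suc (Suc k)) has_real_derivative
           real (Suc (Suc k)) * max 0 z ^ Suc k) (at z)" for z
  proof -
    consider "z > 0" | "z < 0" | "z = 0" by linarith
    then show ?thesis
    proof cases
      case 1
      have "((\<lambda>z::real. z ^ Suc (Suc k)) has_real_derivative real (Suc (Suc k)) * z ^ Suc k) (at z)"
        by (rule derivative_eq_intros refl)+ simp
      moreover have "\<forall>\<^sub>F w in nhds z. w ^ Suc (Suc k) = max 0 w ^ Suc (Suc k)"
        using eventually_nhds_in_open[of "{0<..}" z] 1 by (auto elim!: eventually_mono)
      ultimately show ?thesis
        using 1 by (subst DERIV_cong_ev[OF refl _ refl, where g="\<lambda>w. w ^ Suc (Suc k)"])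
          (auto elim: eventually_mono)
    next
      case 2
      have "((\<lambda>z::real. 0) has_real_derivative 0) (at z)" by simp
      moreover have "\<forall>\<^sub>F w in nhds z. max 0 w ^ Suc (Suc k) = 0"
        using eventually_nhds_in_open[of "{..<0}" z] 2 by (auto elim!: eventually_mono)
      ultimately show ?thesis
        using 2 by (subst DERIV_cong_ev[OF refl _ refl, where g="\<lambda>w. 0"]) auto
    next
      case 3
      have "((\<lambda>h::real. max 0 h ^ Suc (Suc k) / h) \<longlongrightarrow> 0) (at 0)"
      proof (rule Lim_null_comparison)
        show "\<forall>\<^sub>F h::real in at 0. norm (max 0 h ^ Suc (Suc k) / h) \<le> max 0 h ^ Suc k"
          by (intro always_eventually) (auto simp: max_def)
        have "((\<lambda>h::real. max 0 h ^ Suc k) \<longlongrightarrow> max 0 0 ^ Suc k) (at 0)"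
          by (intro tendsto_intros)
        then show "((\<lambda>h::real. max 0 h ^ Suc k) \<longlongrightarrow> 0) (at 0)" by simp
      qed
      then show ?thesis using 3 by (simp add: DERIV_def)
    qed
  qed
  from DERIV_chain2[OF this assms] show ?thesis by simp
qed

lemma powr_ge_power_of_le_one:
  fixes g :: real
  assumes g: "0 \<le> g" "g \<le> 1" and k: "k \<ge> 1" and m: "real m * a \<le> real k"
  shows "g ^ k \<le> (g ^ m) powr a"
proof (cases "g = 0")
  case True
  then show ?thesis using k by (simp add: power_0_left)
next
  case False
  then have "g > 0" using g by simp
  then have "(g ^ m) powr a = g powr (real m * a)" "g ^ k = g powr real k"
    by (simp_all add: powr_powr flip: powr_realpow)
  then show ?thesis using m g False by (simp add: powr_mono')
qed

text \<open>Young's inequality will divide by a power of the test function, so its derivatives have to be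
dominated by \<open>\<xi> powr (1 / p)\<close>, even where \<open>\<xi>\<close> vanishes. A high power \<open>\<xi> = G ^ m\<close> of a
transition \<open>G\<close> from \<open>0\<close> to \<open>1\<close> does this: two derivatives cost two factors \<open>G\<close>, and
\<open>G ^ (m - 2) \<le> (G ^ m) powr (1 / p)\<close> once \<open>m\<close> is large. Here \<open>G\<close> is the positive part of
\<open>1 - (max 0 (1 - y)) ^ 3\<close>, which joins the constant \<open>1\<close> twice continuously differentiably at
\<open>y = 1\<close>; its corner at \<open>y = 0\<close> is removed by the power.\<close>
lemma cutoff_exists:
  fixes p :: real
  assumes p: "p > 1"
  obtains \<xi> \<xi>1 \<xi>2 :: "real \<Rightarrow> real" and C where
    "C > 0"
    "second_derivs UNIV \<xi> \<xi>1 \<xi>2"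
    "\<And>y. 0 \<le> \<xi> y" "\<And>y. \<xi> y \<le> 1"
    "\<And>y. y \<le> 0 \<Longrightarrow> \<xi> y = 0" "\<And>y. y \<ge> 1 \<Longrightarrow> \<xi> y = 1"
    "\<And>y. y \<ge> 1 \<Longrightarrow> \<xi>1 y = 0" "\<And>y. y \<ge> 1 \<Longrightarrow> \<xi>2 y = 0"
    "\<And>y. \<bar>\<xi>1 y\<bar> \<le> C * \<xi> y powr (1 / p)"
    "\<And>y. \<bar>\<xi>2 y\<bar> \<le> C * \<xi> y powr (1 / p)"
proof -
  \<comment> \<open>The exponent \<open>m = k + 3\<close> satisfies \<open>m / p \<le> k\<close> exactly when \<open>k (p - 1) \<ge> 3\<close>.\<close>
  obtain k :: nat where k: "real k \<ge> 3 / (p - 1)" "k \<ge> 1"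
    using real_nat_ceiling_ge[of "3 / (p - 1)"]
    by (meson max.cobounded1 max.cobounded2 of_nat_mono order_trans that)
  define m where "m = Suc (Suc (Suc k))"
  have kp: "real m * (1 / p) \<le> real k"
    using k p unfolding m_def by (simp add: field_simps)
  let ?q = "\<lambda>y::real. max 0 (1 - y)"
  define g where "g y = 1 - ?q y ^ 3" for y
  define g1 where "g1 y = 3 * ?q y ^ 2" for y
  define g2 where "g2 y = - 6 * ?q y" for y
  define G where "G y = max 0 (g y)" for y
  have dg: "(g has_real_derivative g1 y) (at y)" for y
  proof -
    have "((\<lambda>y. ?q y ^ Suc (Suc 1)) has_real_derivative real (Suc (Suc 1)) * ?q y ^ Suc 1 * (-1)) (at y)"
      by (rule pos_part_power_has_derivative) (auto intro!: derivative_eq_intros)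
    then have "((\<lambda>y. ?q y ^ 3) has_real_derivative - (3 * ?q y ^ 2)) (at y)"
      by (simp add: eval_nat_numeral)
    from DERIV_diff[OF DERIV_const[of 1] this] show ?thesis
      by (simp add: g_def[abs_def] g1_def)
  qed
  have dg1: "(g1 has_real_derivative g2 y) (at y)" for y
  proof -
    have "((\<lambda>y. ?q y ^ Suc (Suc 0)) has_real_derivative real (Suc (Suc 0)) * ?q y ^ Suc 0 * (-1)) (at y)"
      by (rule pos_part_power_has_derivative) (auto intro!: derivative_eq_intros)
    then have "((\<lambda>y. ?q y ^ 2) has_real_derivative - (2 * ?q y)) (at y)"
      by (simp add: eval_nat_numeral)
    from DERIV_cmult[OF this, of 3] show ?thesis
      by (simp add: g1_def[abs_def] g2_def)
  qed
  have cg: "continuous_on UNIV g" "continuous_on UNIV g1" "continuous_on UNIV g2"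
    unfolding g_def g1_def g2_def by (intro continuous_intros)+
  have g_ge1: "g y = 1" "g1 y = 0" "g2 y = 0" "G y = 1" if "y \<ge> 1" for y
    using that by (auto simp: g_def g1_def g2_def G_def)
  have g_le0: "G y = 0" if "y \<le> 0" for y
    using that one_le_power[of "1 - y" 3] by (auto simp: g_def G_def)
  have G01: "0 \<le> G y" "G y \<le> 1" for y by (auto simp: G_def g_def)
  have q01: "0 \<le> ?q y" "?q y \<le> 1" if "y > 0" for y using that by auto
  have g1_bd: "\<bar>g1 y\<bar> \<le> 3" and g2_bd: "\<bar>g2 y\<bar> \<le> 6" if "y > 0" for y
    using q01[OF that] power_le_one[OF q01[OF that], of 2] by (auto simp: g1_def g2_def)
  define \<xi> where "\<xi> y = G y ^ m" for y
  define \<xi>1 where "\<xi>1 y = real m * G y ^ Suc (Suc k) * g1 y" for y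
  define \<xi>2 where "\<xi>2 y = real m * (real (Suc (Suc k)) * G y ^ Suc k * g1 y * g1 y + G y ^ Suc (Suc k) * g2 y)" for y
  define C where "C = real m * (9 * real m + 6)"
  have bd: "\<bar>\<xi>1 y\<bar> \<le> C * G y ^ k" "\<bar>\<xi>2 y\<bar> \<le> C * G y ^ k" for y
  proof -
    have "\<bar>\<xi>1 y\<bar> \<le> C * G y ^ k \<and> \<bar>\<xi>2 y\<bar> \<le> C * G y ^ k"
    proof (cases "y \<le> 0")
      case True
      then show ?thesis using k(2) g_le0 by (simp add: \<xi>1_def \<xi>2_def power_0_left)
    next
      case False
      then have y: "\<bar>g1 y\<bar> \<le> 3" "\<bar>g2 y\<bar> \<le> 6" using g1_bd g2_bd by auto
      have d: "G y ^ Suc k \<le> G y ^ k" "G y ^ Suc (Suc k) \<le> G y ^ k"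
        by (rule power_decreasing; use G01 in auto)+
      have nn: "0 \<le> G y ^ j" for j using G01 by simp
      have e1: "\<bar>G y ^ Suc (Suc k) * g1 y\<bar> \<le> G y ^ k * 3"
        unfolding abs_mult using y d nn
        by (intro mult_mono) (simp_all add: abs_of_nonneg[OF nn] del: power_Suc)
      have e2: "\<bar>G y ^ Suc (Suc k) * g2 y\<bar> \<le> G y ^ k * 6"
        unfolding abs_mult using y d nn
        by (intro mult_mono) (simp_all add: abs_of_nonneg[OF nn] del: power_Suc)
      have "\<bar>g1 y * g1 y\<bar> \<le> 3 * 3" unfolding abs_mult using y by (intro mult_mono) auto
      then have "\<bar>G y ^ Suc k * (g1 y * g1 y)\<bar> \<le> G y ^ k * 9"
        unfolding abs_mult[of "_ ^ _"] using d nn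
        by (intro mult_mono) (simp_all add: abs_of_nonneg[OF nn] del: power_Suc)
      then have e3: "\<bar>real (Suc (Suc k)) * (G y ^ Suc k * (g1 y * g1 y))\<bar> \<le> real m * (G y ^ k * 9)"
        unfolding abs_mult[of "real _"] by (intro mult_mono) (auto simp: m_def)
      have "\<bar>\<xi>1 y\<bar> = real m * \<bar>G y ^ Suc (Suc k) * g1 y\<bar>"
        by (simp add: \<xi>1_def abs_mult)
      also have "\<dots> \<le> real m * (G y ^ k * 3)" using e1 by (intro mult_left_mono) auto
      also have "\<dots> \<le> real m * ((9 * real m + 6) * G y ^ k)"
        using nn[of k] by (intro mult_left_mono) (auto simp: algebra_simps)
      finally have a: "\<bar>\<xi>1 y\<bar> \<le> C * G y ^ k" by (simp add: C_def algebra_simps)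
      have "\<bar>\<xi>2 y\<bar> = real m * \<bar>real (Suc (Suc k)) * (G y ^ Suc k * (g1 y * g1 y)) + G y ^ Suc (Suc k) * g2 y\<bar>"
        unfolding \<xi>2_def by (simp only: abs_mult mult.assoc abs_of_nat)
      also have "\<dots> \<le> real m * (real m * (G y ^ k * 9) + G y ^ k * 6)"
        using e2 e3 by (intro mult_left_mono) linarith+
      also have "\<dots> = C * G y ^ k" by (simp add: C_def algebra_simps)
      finally show ?thesis using a by simp
    qed
    then show "\<bar>\<xi>1 y\<bar> \<le> C * G y ^ k" "\<bar>\<xi>2 y\<bar> \<le> C * G y ^ k" by auto
  qed
  have C: "C > 0" by (simp add: C_def m_def)
  have pw: "G y ^ k \<le> \<xi> y powr (1 / p)" for y
    unfolding \<xi>_def by (rule powr_ge_power_of_le_one[OF G01 k(2) kp])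
  have sd: "second_derivs UNIV \<xi> \<xi>1 \<xi>2"
    unfolding second_derivs_def
  proof (intro conjI ballI)
    show "(\<xi> has_real_derivative \<xi>1 y) (at y)" for y
      using pos_part_power_has_derivative[OF dg[of y], of "Suc k"]
      unfolding \<xi>_def[abs_def] \<xi>1_def G_def m_def .
    show "(\<xi>1 has_real_derivative \<xi>2 y) (at y)" for y
    proof -
      have "((\<lambda>y. G y ^ Suc (Suc k)) has_real_derivative
          real (Suc (Suc k)) * G y ^ Suc k * g1 y) (at y)"
        unfolding G_def by (rule pos_part_power_has_derivative[OF dg])
      from DERIV_cmult[OF DERIV_mult[OF this dg1], of "real m"]
      show ?thesis by (simp add: \<xi>1_def[abs_def] \<xi>2_def algebra_simps)
    qed
    show "continuous_on UNIV \<xi>2"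
      unfolding \<xi>2_def G_def by (intro continuous_intros cg)
  qed
  show thesis
  proof (rule that[of C \<xi> \<xi>1 \<xi>2])
    show "\<bar>\<xi>1 y\<bar> \<le> C * \<xi> y powr (1 / p)" for y
      using bd(1)[of y] mult_left_mono[OF pw[of y], of C] C by linarith
    show "\<bar>\<xi>2 y\<bar> \<le> C * \<xi> y powr (1 / p)" for y
      using bd(2)[of y] mult_left_mono[OF pw[of y], of C] C by linarith
    show "\<xi> y \<le> 1" for y using G01 by (simp add: \<xi>_def power_le_one)
    show "\<xi> y = 0" if "y \<le> 0" for y using g_le0[OF that] by (simp add: \<xi>_def m_def)
  qed (use C sd G01 g_ge1 in \<open>auto simp: \<xi>_def \<xi>1_def \<xi>2_def\<close>)
qed

section \<open>Time and radial cutoffs\<close>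

lemma le_powr_of_le_one:
  fixes x a :: real
  assumes "0 \<le> x" "x \<le> 1" "a \<le> 1"
  shows "x \<le> x powr a"
  using powr_mono'[of a 1 x] assms by (cases "x = 0") auto

text \<open>The bump rises on the first third of \<open>[n, 2 n]\<close>, equals \<open>1\<close> on the second and falls on the last.
Rescaling by \<open>n\<close> gives \<open>1 / n\<close> for the first derivative and \<open>1 / n\<^sup>2 \<le> 1 / n\<close> for the second, so
one bound serves both the parabolic and the hyperbolic inequality.\<close>
lemma time_cutoff_exists:
  fixes p :: real
  assumes p: "p > 1"
  obtains E where "E > 0"
    "\<And>n. n \<ge> (1::nat) \<Longrightarrow> \<exists>\<eta> \<eta>1 \<eta>2. second_derivs UNIV \<eta> \<eta>1 \<eta>2 \<and> (\<forall>t. 0 \<le> \<eta> t \<and> \<eta> t \<le> 1) \<and>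
       (\<forall>t. t \<notin> {real n..2 * real n} \<longrightarrow> \<eta> t = 0 \<and> \<eta>1 t = 0 \<and> \<eta>2 t = 0) \<and>
       (\<forall>t. \<bar>\<eta>1 t\<bar> \<le> E / real n * \<eta> t powr (1 / p)) \<and> (\<forall>t. \<bar>\<eta>2 t\<bar> \<le> E / real n * \<eta> t powr (1 / p)) \<and>
       integrable lborel \<eta> \<and> real n / 3 \<le> (LINT t|lborel. \<eta> t)"
proof -
  obtain \<xi> \<xi>1 \<xi>2 :: "real \<Rightarrow> real" and C where C: "C > 0"
    and sd: "second_derivs UNIV \<xi> \<xi>1 \<xi>2"
    and \<xi>01: "\<And>y. 0 \<le> \<xi> y" "\<And>y. \<xi> y \<le> 1"
    and \<xi>0: "\<And>y. y \<le> 0 \<Longrightarrow> \<xi> y = 0" and \<xi>1: "\<And>y. y \<ge> 1 \<Longrightarrow> \<xi> y = 1"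
    and bd: "\<And>y. \<bar>\<xi>1 y\<bar> \<le> C * \<xi> y powr (1 / p)" "\<And>y. \<bar>\<xi>2 y\<bar> \<le> C * \<xi> y powr (1 / p)"
    by (rule cutoff_exists[OF p], rule that; assumption)
  define E where "E = 18 * (C + C\<^sup>2)"
  show thesis
  proof (rule that[of E])
    show "E > 0" using C by (simp add: E_def add_pos_pos)
    fix n :: nat assume n: "n \<ge> 1"
    define c where "c = 3 / real n"
    have c: "0 < c" "c \<le> 3" "c * real n = 3" using n by (auto simp: c_def field_simps)
    define a where "a t = c * t - 3" for t
    define b where "b t = 6 - c * t" for t
    have sa: "second_derivs UNIV a (\<lambda>_. c) (\<lambda>_. 0)" and sb: "second_derivs UNIV b (\<lambda>_. - c) (\<lambda>_. 0)"
      unfolding second_derivs_def a_def b_def by (auto intro!: derivative_eq_intros)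
    define \<eta> where "\<eta> t = \<xi> (a t) * \<xi> (b t)" for t
    define \<eta>1 where "\<eta>1 t = \<xi>1 (a t) * c * \<xi> (b t) + \<xi> (a t) * (\<xi>1 (b t) * - c)" for t
    define \<eta>2 where "\<eta>2 t = (\<xi>2 (a t) * c\<^sup>2 + \<xi>1 (a t) * 0) * \<xi> (b t)
        + 2 * (\<xi>1 (a t) * c * (\<xi>1 (b t) * - c))
        + \<xi> (a t) * (\<xi>2 (b t) * (- c)\<^sup>2 + \<xi>1 (b t) * 0)" for t
    have sd\<eta>: "second_derivs UNIV \<eta> \<eta>1 \<eta>2"
      using second_derivs_mult[OF second_derivs_compose[OF sd sa] second_derivs_compose[OF sd sb]]
      unfolding \<eta>_def[abs_def] \<eta>1_def[abs_def] \<eta>2_def[abs_def] .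
    have r01: "0 \<le> \<eta> t" "\<eta> t \<le> 1" for t
      using \<xi>01 by (auto simp: \<eta>_def intro: mult_le_one)
    have off: "\<eta> t = 0" if "t \<notin> {real n..2 * real n}" for t
    proof -
      have "t < real n \<or> 2 * real n < t" using that by auto
      then have "c * t \<le> c * real n \<or> c * (2 * real n) \<le> c * t"
        by (rule disj_forward; intro mult_left_mono; use c(1) in simp)
      moreover have "c * (2 * real n) = 6" using c(3) by simp
      ultimately have "a t \<le> 0 \<or> b t \<le> 0" unfolding a_def b_def using c(3) by linarith
      then show ?thesis using \<xi>0 by (auto simp: \<eta>_def)
    qed
    have P: "\<bar>x * y\<bar> \<le> (A * B) * \<eta> t powr (1 / p)"
      if "\<bar>x\<bar> \<le> A * \<xi> (a t) powr (1 / p)" "\<bar>y\<bar> \<le> B * \<xi> (b t) powr (1 / p)" "A \<ge> 0" "B \<ge> 0" for x y A B t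
    proof -
      have "\<bar>x\<bar> * \<bar>y\<bar> \<le> (A * \<xi> (a t) powr (1 / p)) * (B * \<xi> (b t) powr (1 / p))"
        using that by (intro mult_mono) auto
      also have "\<dots> = (A * B) * \<eta> t powr (1 / p)" using \<xi>01 by (simp add: \<eta>_def powr_mult)
      finally show ?thesis by (simp add: abs_mult)
    qed
    have \<xi>p: "\<bar>\<xi> y\<bar> \<le> 1 * \<xi> y powr (1 / p)" for y
      using le_powr_of_le_one[OF \<xi>01, of "1 / p" y] \<xi>01 p by simp
    define G where "G t = \<eta> t powr (1 / p)" for t
    have G: "G t \<ge> 0" for t by (simp add: G_def)
    have b1: "\<bar>\<eta>1 t\<bar> \<le> E / real n * G t" for t
    proof -
      have 1: "\<bar>\<xi>1 (a t) * \<xi> (b t)\<bar> \<le> (C * 1) * G t" "\<bar>\<xi> (a t) * \<xi>1 (b t)\<bar> \<le> (1 * C) * G t"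
        unfolding G_def using C by (intro P bd \<xi>p; simp)+
      have "\<bar>\<eta>1 t\<bar> = \<bar>c * (\<xi>1 (a t) * \<xi> (b t) - \<xi> (a t) * \<xi>1 (b t))\<bar>"
        by (simp add: \<eta>1_def algebra_simps)
      also have "\<dots> = c * \<bar>\<xi>1 (a t) * \<xi> (b t) - \<xi> (a t) * \<xi>1 (b t)\<bar>" using c by (simp add: abs_mult)
      also have "\<dots> \<le> c * ((2 * C) * G t)" using c 1 by (intro mult_left_mono) auto
      also have "\<dots> \<le> c * ((6 * (C + C\<^sup>2)) * G t)"
        using c C G by (intro mult_left_mono mult_right_mono) auto
      also have "\<dots> = E / real n * G t" by (simp add: E_def c_def)
      finally show ?thesis .
    qed
    have b2: "\<bar>\<eta>2 t\<bar> \<le> E / real n * G t" for t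
    proof -
      have 1: "\<bar>\<xi>2 (a t) * \<xi> (b t)\<bar> \<le> (C * 1) * G t" "\<bar>\<xi> (a t) * \<xi>2 (b t)\<bar> \<le> (1 * C) * G t"
        "\<bar>\<xi>1 (a t) * \<xi>1 (b t)\<bar> \<le> (C * C) * G t"
        unfolding G_def using C by (intro P bd \<xi>p; simp)+
      have "\<bar>\<eta>2 t\<bar> = \<bar>c\<^sup>2 * (\<xi>2 (a t) * \<xi> (b t) - 2 * (\<xi>1 (a t) * \<xi>1 (b t)) + \<xi> (a t) * \<xi>2 (b t))\<bar>"
        by (simp add: \<eta>2_def algebra_simps power2_eq_square)
      also have "\<dots> = c\<^sup>2 * \<bar>\<xi>2 (a t) * \<xi> (b t) - 2 * (\<xi>1 (a t) * \<xi>1 (b t)) + \<xi> (a t) * \<xi>2 (b t)\<bar>"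
        by (simp add: abs_mult)
      also have "\<dots> \<le> c\<^sup>2 * (2 * (C * G t) + 2 * (C * C * G t))" using 1 by (intro mult_left_mono) auto
      also have "\<dots> \<le> (3 * c) * (2 * (C * G t) + 2 * (C * C * G t))"
        using c C G[of t] by (intro mult_right_mono) (auto simp: power2_eq_square)
      also have "\<dots> = E / real n * G t" by (simp add: E_def c_def field_simps power2_eq_square)
      finally show ?thesis .
    qed
    have m: "\<eta> \<in> borel_measurable borel"
      by (intro borel_measurable_continuous_onI second_derivs_continuous[OF sd\<eta>])
    have ie: "integrable lborel (indicator {u..v} :: real \<Rightarrow> real)" for u v :: real
      by (intro integrable_real_indicator) (auto simp: emeasure_lborel_Icc_eq)
    have i\<eta>: "integrable lborel \<eta>"
      by (rule Bochner_Integration.integrable_bound[OF ie[of "real n" "2 * real n"]])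
        (use m r01 off in \<open>auto simp: indicator_def intro!: AE_I2\<close>)
    have one: "indicator {4 / 3 * real n..5 / 3 * real n} t \<le> \<eta> t" for t
    proof (cases "t \<in> {4 / 3 * real n..5 / 3 * real n}")
      case True
      then have "4 / 3 * real n \<le> t" "t \<le> 5 / 3 * real n" by auto
      then have "c * (4 / 3 * real n) \<le> c * t" "c * t \<le> c * (5 / 3 * real n)"
        using c(1) by (intro mult_left_mono; simp)+
      then have "a t \<ge> 1" "b t \<ge> 1" unfolding a_def b_def using c(3) by linarith+
      then show ?thesis using True \<xi>1 by (simp add: \<eta>_def)
    qed (use r01 in auto)
    have "real n / 3 = (LINT t|lborel. indicator {4 / 3 * real n..5 / 3 * real n} t)"
      by (simp add: field_simps)
    also have "\<dots> \<le> (LINT t|lborel. \<eta> t)"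
      by (intro integral_mono ie i\<eta> one)
    finally have big: "real n / 3 \<le> (LINT t|lborel. \<eta> t)" .
    show "\<exists>\<eta> \<eta>1 \<eta>2. second_derivs UNIV \<eta> \<eta>1 \<eta>2 \<and> (\<forall>t. 0 \<le> \<eta> t \<and> \<eta> t \<le> 1) \<and>
       (\<forall>t. t \<notin> {real n..2 * real n} \<longrightarrow> \<eta> t = 0 \<and> \<eta>1 t = 0 \<and> \<eta>2 t = 0) \<and>
       (\<forall>t. \<bar>\<eta>1 t\<bar> \<le> E / real n * \<eta> t powr (1 / p)) \<and> (\<forall>t. \<bar>\<eta>2 t\<bar> \<le> E / real n * \<eta> t powr (1 / p)) \<and>
       integrable lborel \<eta> \<and> real n / 3 \<le> (LINT t|lborel. \<eta> t)"
    proof (rule exI[of _ \<eta>], rule exI[of _ \<eta>1], rule exI[of _ \<eta>2], intro conjI allI impI)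
      fix t assume t: "t \<notin> {real n..2 * real n}"
      show "\<eta>1 t = 0" "\<eta>2 t = 0" using b1[of t] b2[of t] off[OF t] by (simp_all add: G_def)
    qed (use sd\<eta> r01 off b1 b2 i\<eta> big in \<open>auto simp: G_def\<close>)
  qed
qed

text \<open>A radial weight \<open>H (norm x)\<close> that is harmonic in dimension \<open>N\<close>, so that a spatial cutoff times \<open>H\<close>
has no Laplacian except where the cutoff varies. That happens only for \<open>norm x \<le> 3/2\<close>, hence the
lower bound \<open>c\<close> is required only there and \<open>H\<close> may vanish on the outer sphere.\<close>
definition harmonic_profile ::
  "real \<Rightarrow> (real \<Rightarrow> real) \<Rightarrow> (real \<Rightarrow> real) \<Rightarrow> (real \<Rightarrow> real) \<Rightarrow> real \<Rightarrow> real \<Rightarrow> bool" where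
  "harmonic_profile N H H1 H2 M c \<longleftrightarrow> second_derivs {1<..} H H1 H2 \<and>
     (\<forall>r>1. H2 r + (N - 1) / r * H1 r = 0) \<and>
     (\<forall>r. 1 < r \<and> r \<le> 2 \<longrightarrow> 0 \<le> H r \<and> H r \<le> M \<and> \<bar>H1 r\<bar> \<le> M) \<and>
     (\<forall>r. 1 < r \<and> r \<le> 3/2 \<longrightarrow> c \<le> H r) \<and> M \<ge> 1 \<and> c > 0"

lemma harmonic_profile_one: "harmonic_profile N (\<lambda>_. 1) (\<lambda>_. 0) (\<lambda>_. 0) 1 1"
  by (auto simp: harmonic_profile_def second_derivs_def)

text \<open>The fundamental solution, shifted to vanish on the sphere of radius \<open>2\<close>. Its slope there is strictly
negative, so the boundary term of the Dirichlet problem is a positive multiple of the integral of the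
boundary datum.\<close>
lemma Dirichlet_profile_exists:
  fixes N :: real
  assumes N: "N \<ge> 2"
  obtains H H1 H2 M c where "harmonic_profile N H H1 H2 M c" "H 2 = 0" "H1 2 < 0"
proof -
  define H where "H r = (if N = 2 then ln 2 - ln r else (r powr (2 - N) - 2 powr (2 - N)) / (N - 2))" for r :: real
  define H1 where "H1 r = - (r powr (1 - N))" for r :: real
  define H2 where "H2 r = (N - 1) * r powr (- N)" for r :: real
  have d1: "(H has_real_derivative H1 r) (at r)" if "r > 0" for r
  proof (cases "N = 2")
    case True
    have "((\<lambda>r. ln 2 - ln r) has_real_derivative - (1 / r)) (at r)"
      using that by (auto intro!: derivative_eq_intros)
    then show ?thesis
      using True that by (simp add: H_def[abs_def] H1_def powr_minus divide_inverse)
  next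
    case False
    have "((\<lambda>r. (r powr (2 - N) - 2 powr (2 - N)) / (N - 2)) has_real_derivative
        ((2 - N) * r powr (2 - N - 1)) / (N - 2)) (at r)"
      using that False by (auto intro!: derivative_eq_intros)
    moreover have "((2 - N) * r powr (2 - N - 1)) / (N - 2) = H1 r"
      using False by (simp add: H1_def field_simps)
    ultimately show ?thesis using False by (simp add: H_def[abs_def])
  qed
  have d2: "(H1 has_real_derivative H2 r) (at r)" if "r > 0" for r
  proof -
    have "((\<lambda>r. - (r powr (1 - N))) has_real_derivative - ((1 - N) * r powr (1 - N - 1))) (at r)"
      using that by (auto intro!: derivative_eq_intros)
    then show ?thesis by (simp add: H1_def[abs_def] H2_def algebra_simps)
  qed
  have sd: "second_derivs {1<..} H H1 H2"
    unfolding second_derivs_def using d1 d2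
    by (auto simp: H2_def intro!: continuous_intros)
  have harm: "H2 r + (N - 1) / r * H1 r = 0" if "r > 1" for r
  proof -
    have "r powr (1 - N) = r * r powr (- N)"
      using that powr_add[of r 1 "- N"] by simp
    then show ?thesis using that by (simp add: H1_def H2_def)
  qed
  have dec: "H y < H x" if "0 < x" "x < y" for x y
  proof (rule DERIV_neg_imp_decreasing[OF that(2)])
    fix z assume "x \<le> z" "z \<le> y"
    then have "z > 0" using that by simp
    with d1[OF this] show "\<exists>d. (H has_real_derivative d) (at z) \<and> d < 0"
      by (intro exI[of _ "H1 z"]) (simp add: H1_def)
  qed
  have H2: "H 2 = 0" by (simp add: H_def)
  have "H (3/2) > 0" using dec[of "3/2" 2] H2 by simp
  moreover have "0 \<le> H r" "H r \<le> max 1 (H 1)" "\<bar>H1 r\<bar> \<le> max 1 (H 1)" if "1 < r" "r \<le> 2" for r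
  proof -
    show "0 \<le> H r" using dec[of r 2] H2 that by (cases "r = 2") auto
    show "H r \<le> max 1 (H 1)" using dec[of 1 r] that by simp
    have "r powr (1 - N) \<le> r powr 0" using that N by (intro powr_mono) auto
    then show "\<bar>H1 r\<bar> \<le> max 1 (H 1)" using that by (simp add: H1_def)
  qed
  moreover have "H (3/2) \<le> H r" if "1 < r" "r \<le> 3/2" for r
  proof (cases "r < 3/2")
    case False
    have "r = 3/2" using False that by linarith
    show ?thesis by (simp only: \<open>r = 3/2\<close> order_refl)
  qed (use dec[of r "3/2"] that in simp)
  ultimately have "harmonic_profile N H H1 H2 (max 1 (H 1)) (H (3/2))"
    using sd harm by (auto simp: harmonic_profile_def)
  then show thesis using H2 by (rule that) (simp add: H1_def)
qed

text \<open>The cutoff is taken in the variable \<open>ln (norm x - 1)\<close> and spreads the transition over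
\<open>(1/2) ^ (n + 1) \<le> norm x - 1 \<le> 1/2\<close>. Each derivative then produces a factor
\<open>1 / (norm x - 1)\<close>, as scaling demands, but the whole Laplacian gains a factor \<open>1 / n\<close> over a
transition inside a single dyadic ring. This gain is what decides the critical case.\<close>
lemma radial_cutoff_exists:
  fixes p N M c :: real
  assumes p: "p > 1" and N: "N \<ge> 1" and prof: "harmonic_profile N H H1 H2 M c"
  obtains B where "B > 0"
    "\<And>n. n \<ge> (1::nat) \<Longrightarrow> \<exists>F F1 F2. second_derivs {1<..} F F1 F2 \<and> F 2 = H 2 \<and> F1 2 = H1 2 \<and>
       (\<forall>r. 1 < r \<and> r \<le> 2 \<longrightarrow> 0 \<le> F r \<and> F r \<le> M) \<and>
       (\<forall>r. 1 < r \<and> r \<le> 1 + (1/2) ^ Suc n \<longrightarrow> F r = 0 \<and> F1 r = 0 \<and> F2 r = 0) \<and>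
       (\<forall>r. 1 < r \<and> r \<le> 2 \<longrightarrow> r - 1 > 1/2 \<longrightarrow> F2 r + (N - 1) / r * F1 r = 0) \<and>
       (\<forall>r. 1 < r \<and> r - 1 \<le> 1/2 \<longrightarrow>
          \<bar>F2 r + (N - 1) / r * F1 r\<bar> \<le> B / real n * F r powr (1 / p) * (r - 1) powr (- 2))"
proof -
  obtain \<xi> \<xi>1 \<xi>2 :: "real \<Rightarrow> real" and C where C: "C > 0"
    and sd: "second_derivs UNIV \<xi> \<xi>1 \<xi>2"
    and \<xi>01: "\<And>y. 0 \<le> \<xi> y" "\<And>y. \<xi> y \<le> 1"
    and \<xi>0: "\<And>y. y \<le> 0 \<Longrightarrow> \<xi> y = 0"
    and \<xi>1: "\<And>y. y \<ge> 1 \<Longrightarrow> \<xi> y = 1" "\<And>y. y \<ge> 1 \<Longrightarrow> \<xi>1 y = 0" "\<And>y. y \<ge> 1 \<Longrightarrow> \<xi>2 y = 0"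
    and bd: "\<And>y. \<bar>\<xi>1 y\<bar> \<le> C * \<xi> y powr (1 / p)" "\<And>y. \<bar>\<xi>2 y\<bar> \<le> C * \<xi> y powr (1 / p)"
    by (rule cutoff_exists[OF p], rule that; assumption)
  have sH: "second_derivs {1<..} H H1 H2" and harm: "\<And>r. r > 1 \<Longrightarrow> H2 r + (N - 1) / r * H1 r = 0"
    and bH: "\<And>r. 1 < r \<Longrightarrow> r \<le> 2 \<Longrightarrow> 0 \<le> H r \<and> H r \<le> M \<and> \<bar>H1 r\<bar> \<le> M"
    and cH: "\<And>r. 1 < r \<Longrightarrow> r \<le> 3/2 \<Longrightarrow> c \<le> H r" and Mc: "M \<ge> 1" "c > 0"
    using prof by (auto simp: harmonic_profile_def)
  define D where "D = 2 * (C * M * (5 + N))"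
  define B where "B = D * c powr (- (1 / p))"
  have D: "D > 0" using C Mc N by (auto simp: D_def intro!: mult_pos_pos)
  show thesis
  proof (rule that[of B])
    show "B > 0" using D Mc by (simp add: B_def)
    fix n :: nat assume n: "n \<ge> 1"
    \<comment> \<open>The cutoff variable \<open>y r\<close> below runs from \<open>0\<close> at \<open>r - 1 = (1/2) ^ (n + 1)\<close> to \<open>1\<close> at \<open>r - 1 = 1/2\<close>.\<close>
    define l where "l = 1 / (real n * ln 2)"
    have ln2: "ln 2 \<ge> (1/2 :: real)" using ln2_ge_two_thirds by simp
    have l: "0 < l" "l \<le> 2 / real n" "l \<le> 2" "l * (real n * ln 2) = 1"
    proof -
      show "0 < l" "l * (real n * ln 2) = 1" using n by (auto simp: l_def)
      have "1 / (real n * ln 2) \<le> 1 / (real n * (1/2))"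
        using n ln2 by (intro divide_left_mono mult_left_mono) auto
      then show "l \<le> 2 / real n" by (simp add: l_def)
      also have "\<dots> \<le> 2" using n by (simp add: field_simps)
      finally show "l \<le> 2" .
    qed
    define y where "y r = 1 + l * ln (2 * (r - 1))" for r
    define y1 where "y1 r = l / (r - 1)" for r
    define y2 where "y2 r = - (l / (r - 1)\<^sup>2)" for r
    have sy: "second_derivs {1<..} y y1 y2"
      unfolding second_derivs_def y_def y1_def y2_def
    proof (intro conjI ballI)
      fix r :: real assume "r \<in> {1<..}"
      then have r: "r > 1" by simp
      show "((\<lambda>r. 1 + l * ln (2 * (r - 1))) has_real_derivative l / (r - 1)) (at r)"
        using r by (auto intro!: derivative_eq_intros simp: field_simps)
      show "((\<lambda>r. l / (r - 1)) has_real_derivative - (l / (r - 1)\<^sup>2)) (at r)"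
        using r by (auto intro!: derivative_eq_intros simp: power2_eq_square)
    qed (auto intro!: continuous_intros)
    have y_ge: "y r \<ge> 1" if "r - 1 \<ge> 1/2" for r
      using that l(1) by (simp add: y_def)
    have y_le: "y r \<le> 0" if "1 < r" "r \<le> 1 + (1/2) ^ Suc n" for r
    proof -
      have "2 * (r - 1) \<le> (1/2) ^ n" using that by simp
      then have "ln (2 * (r - 1)) \<le> ln ((1/2) ^ n)" using that by (subst ln_le_cancel_iff) auto
      also have "\<dots> = - (real n * ln 2)" by (simp add: ln_realpow ln_div)
      finally have "l * ln (2 * (r - 1)) \<le> l * - (real n * ln 2)" using l(1) by (intro mult_left_mono) auto
      then show ?thesis using l(4) by (simp add: y_def)
    qed
    define F where "F r = H r * \<xi> (y r)" for r
    define F1 where "F1 r = H1 r * \<xi> (y r) + H r * (\<xi>1 (y r) * y1 r)" for r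
    define F2 where "F2 r = H2 r * \<xi> (y r) + 2 * (H1 r * (\<xi>1 (y r) * y1 r))
        + H r * (\<xi>2 (y r) * (y1 r)\<^sup>2 + \<xi>1 (y r) * y2 r)" for r
    have sF: "second_derivs {1<..} F F1 F2"
      using second_derivs_mult[OF sH second_derivs_compose[OF sd sy]]
      unfolding F_def[abs_def] F1_def[abs_def] F2_def[abs_def] .
    \<comment> \<open>The terms with the undifferentiated cutoff cancel because \<open>H\<close> is harmonic.\<close>
    have L: "F2 r + (N - 1) / r * F1 r = \<xi>1 (y r) * y1 r * (2 * H1 r + (N - 1) / r * H r)
        + H r * (\<xi>2 (y r) * (y1 r)\<^sup>2 + \<xi>1 (y r) * y2 r)" if "r > 1" for r
    proof -
      have "F2 r + (N - 1) / r * F1 r = \<xi> (y r) * (H2 r + (N - 1) / r * H1 r)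
        + \<xi>1 (y r) * y1 r * (2 * H1 r + (N - 1) / r * H r)
        + H r * (\<xi>2 (y r) * (y1 r)\<^sup>2 + \<xi>1 (y r) * y2 r)"
        by (simp add: F1_def F2_def algebra_simps)
      then show ?thesis using harm[OF that] by simp
    qed
    have main: "\<bar>F2 r + (N - 1) / r * F1 r\<bar> \<le> B / real n * F r powr (1 / p) * (r - 1) powr (- 2)"
      if r: "1 < r" "r - 1 \<le> 1/2" for r
    proof -
      define s where "s = r - 1"
      have s: "0 < s" "s \<le> 1" using r by (auto simp: s_def)
      define X where "X = \<xi> (y r) powr (1 / p)"
      have X: "X \<ge> 0" "\<bar>\<xi>1 (y r)\<bar> \<le> C * X" "\<bar>\<xi>2 (y r)\<bar> \<le> C * X" using bd by (auto simp: X_def)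
      have Hr: "0 \<le> H r" "H r \<le> M" "\<bar>H1 r\<bar> \<le> M" "c \<le> H r" using bH[of r] cH[of r] r by auto
      define W where "W = l / s\<^sup>2"
      have W: "0 \<le> W" using l s by (simp add: W_def)
      have y1W: "0 \<le> y1 r" "y1 r \<le> W" "(y1 r)\<^sup>2 \<le> 2 * W" "\<bar>y2 r\<bar> = W"
      proof -
        show "0 \<le> y1 r" using l s by (simp add: y1_def s_def)
        have "s\<^sup>2 \<le> s" using s by (simp add: power2_eq_square mult_left_le_one_le)
        then show "y1 r \<le> W" unfolding y1_def W_def s_def[symmetric] using l s
          by (intro divide_left_mono) auto
        have "(y1 r)\<^sup>2 = l * W" by (simp add: y1_def W_def power2_eq_square s_def)
        also have "\<dots> \<le> 2 * W" using l W by (intro mult_right_mono)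
        finally show "(y1 r)\<^sup>2 \<le> 2 * W" .
        show "\<bar>y2 r\<bar> = W" using l by (simp add: y2_def W_def s_def)
      qed
      have Nr: "0 \<le> (N - 1) / r" "(N - 1) / r \<le> N" using N r by (auto simp: field_simps) (smt (verit) mult_less_cancel_left2)
      have NH: "0 \<le> (N - 1) / r * H r" by (rule mult_nonneg_nonneg[OF Nr(1) Hr(1)])
      have NM: "(N - 1) / r * H r \<le> N * M"
        by (rule mult_mono[OF Nr(2) Hr(2)]) (use N Hr(1) in auto)
      have a1: "\<bar>\<xi>1 (y r) * y1 r * (2 * H1 r + (N - 1) / r * H r)\<bar> \<le> C * X * W * (2 * M + N * M)"
        unfolding abs_mult using X y1W Hr NH NM C W
        by (intro mult_mono mult_nonneg_nonneg) auto
      have "\<bar>\<xi>2 (y r) * (y1 r)\<^sup>2\<bar> \<le> C * X * (2 * W)" "\<bar>\<xi>1 (y r) * y2 r\<bar> \<le> C * X * W"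
        unfolding abs_mult using X y1W C W by (intro mult_mono mult_nonneg_nonneg; simp)+
      then have "\<bar>\<xi>2 (y r) * (y1 r)\<^sup>2 + \<xi>1 (y r) * y2 r\<bar> \<le> C * X * W * 3" by (simp add: algebra_simps)
      then have a2: "\<bar>H r * (\<xi>2 (y r) * (y1 r)\<^sup>2 + \<xi>1 (y r) * y2 r)\<bar> \<le> M * (C * X * W * 3)"
        unfolding abs_mult[of "H r"] using Hr by (intro mult_mono) auto
      have "\<bar>F2 r + (N - 1) / r * F1 r\<bar> \<le> C * X * W * (2 * M + N * M) + M * (C * X * W * 3)"
        unfolding L[OF r(1)] using a1 a2 by linarith
      also have "\<dots> = (C * M * (5 + N) * X / s\<^sup>2) * l" by (simp add: W_def algebra_simps add_divide_distrib)
      also have "\<dots> \<le> (C * M * (5 + N) * X / s\<^sup>2) * (2 / real n)"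
        using l C Mc X N by (intro mult_left_mono divide_nonneg_nonneg mult_nonneg_nonneg) auto
      also have "\<dots> = D / real n * X / s\<^sup>2" by (simp add: D_def mult_ac)
      also have "\<dots> \<le> D / real n * (c powr (- (1 / p)) * F r powr (1 / p)) / s\<^sup>2"
      proof -
        have "(c * \<xi> (y r)) powr (1 / p) \<le> F r powr (1 / p)"
          using p Mc Hr \<xi>01 by (intro powr_mono2) (auto simp: F_def intro: mult_right_mono)
        then have "c powr (1 / p) * X \<le> F r powr (1 / p)"
          using Mc \<xi>01 by (simp add: powr_mult X_def)
        then have "c powr (- (1 / p)) * (c powr (1 / p) * X) \<le> c powr (- (1 / p)) * F r powr (1 / p)"
          by (intro mult_left_mono) auto
        moreover have "c powr (- (1 / p)) * (c powr (1 / p) * X) = X"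
          using Mc by (simp add: powr_minus)
        ultimately show ?thesis using D by (intro divide_right_mono mult_left_mono) auto
      qed
      also have "\<dots> = B / real n * F r powr (1 / p) * s powr (- 2)"
        using s by (simp add: B_def powr_minus divide_inverse powr_numeral)
      finally show ?thesis by (simp add: s_def)
    qed
    have zero: "F r = 0 \<and> F1 r = 0 \<and> F2 r = 0" if "1 < r" "r \<le> 1 + (1/2) ^ Suc n" for r
    proof -
      have "\<xi> (y r) = 0" using \<xi>0[OF y_le[OF that]] .
      moreover from this have "\<xi>1 (y r) = 0" "\<xi>2 (y r) = 0" using bd[of "y r"] by simp_all
      ultimately show ?thesis by (simp add: F_def F1_def F2_def)
    qed
    have rng: "0 \<le> F r \<and> F r \<le> M" if "1 < r" "r \<le> 2" for r
      using bH[OF that] \<xi>01[of "y r"] mult_mono[of "H r" M "\<xi> (y r)" 1] by (auto simp: F_def)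
    have far: "F2 r + (N - 1) / r * F1 r = 0" if "1 < r" "r - 1 > 1/2" for r
      unfolding L[OF that(1)] using \<xi>1 y_ge[of r] that by simp
    have two: "F 2 = H 2" "F1 2 = H1 2"
      using \<xi>1 y_ge[of 2] by (auto simp: F_def F1_def)
    show "\<exists>F F1 F2. second_derivs {1<..} F F1 F2 \<and> F 2 = H 2 \<and> F1 2 = H1 2 \<and>
       (\<forall>r. 1 < r \<and> r \<le> 2 \<longrightarrow> 0 \<le> F r \<and> F r \<le> M) \<and>
       (\<forall>r. 1 < r \<and> r \<le> 1 + (1/2) ^ Suc n \<longrightarrow> F r = 0 \<and> F1 r = 0 \<and> F2 r = 0) \<and>
       (\<forall>r. 1 < r \<and> r \<le> 2 \<longrightarrow> r - 1 > 1/2 \<longrightarrow> F2 r + (N - 1) / r * F1 r = 0) \<and>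
       (\<forall>r. 1 < r \<and> r - 1 \<le> 1/2 \<longrightarrow>
          \<bar>F2 r + (N - 1) / r * F1 r\<bar> \<le> B / real n * F r powr (1 / p) * (r - 1) powr (- 2))"
      using sF two rng zero far main by blast
  qed
qed

section \<open>Derivatives of radial test functions\<close>

lemma pderiv_dir_eq:
  assumes "(g has_derivative D) (at z)"
  shows "((\<lambda>s. g (z + s *\<^sub>R v)) has_real_derivative D v) (at 0)" "pderiv_dir v g z = D v"
proof -
  interpret bounded_linear D using assms by (rule has_derivative_bounded_linear)
  have l: "((\<lambda>s. z + s *\<^sub>R v) has_derivative (\<lambda>s. s *\<^sub>R v)) (at 0)"
    by (auto intro!: derivative_eq_intros)
  have "((\<lambda>s. g (z + s *\<^sub>R v)) has_derivative (\<lambda>s. D (s *\<^sub>R v))) (at 0)"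
    using has_derivative_compose[OF l, of g D] assms by simp
  then show "((\<lambda>s. g (z + s *\<^sub>R v)) has_real_derivative D v) (at 0)"
    by (simp add: scaleR has_field_derivative_def mult_commute_abs)
  then show "pderiv_dir v g z = D v"
    unfolding pderiv_dir_def by (rule DERIV_imp_deriv)
qed

lemma eventually_line_in_open:
  fixes z v :: "'b::real_normed_vector"
  assumes "open U" "z \<in> U"
  shows "\<forall>\<^sub>F s in nhds 0. z + s *\<^sub>R v \<in> U"
proof -
  have "((\<lambda>s. z + s *\<^sub>R v) \<longlongrightarrow> z + 0 *\<^sub>R v) (nhds 0)"
    by (intro tendsto_intros filterlim_ident)
  then show ?thesis using assms by (simp add: tendsto_def)
qed

lemma pderiv_dir_cong:
  assumes "open U" "z \<in> U" "\<And>w. w \<in> U \<Longrightarrow> g w = h w"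
  shows "pderiv_dir v g z = pderiv_dir v h z"
  unfolding pderiv_dir_def
  by (rule deriv_cong_ev[OF _ refl])
    (rule eventually_mono[OF eventually_line_in_open[OF assms(1,2)] assms(3)])

text \<open>A partial derivative is known explicitly only on an open set; this transfers differentiability from
the explicit expression to the partial derivative itself.\<close>
lemma C1_on_cong:
  assumes U: "open U" and eq: "\<And>w. w \<in> U \<Longrightarrow> g w = h w"
  shows "C1_on U g \<longleftrightarrow> C1_on U h"
proof -
  have "(\<lambda>s. g (z + s *\<^sub>R i)) differentiable (at 0) \<longleftrightarrow> (\<lambda>s. h (z + s *\<^sub>R i)) differentiable (at 0)"
    if z: "z \<in> U" for z i
  proof -
    have ev: "\<forall>\<^sub>F s in nhds 0. g (z + s *\<^sub>R i) = h (z + s *\<^sub>R i)"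
      using eventually_line_in_open[OF U z] by (rule eventually_mono) (use eq in auto)
    have "(\<lambda>s. g (z + s *\<^sub>R i)) field_differentiable (at 0) \<longleftrightarrow> (\<lambda>s. h (z + s *\<^sub>R i)) field_differentiable (at 0)"
      unfolding field_differentiable_def by (simp only: DERIV_cong_ev[OF refl ev refl])
    then show ?thesis by (simp only: real_differentiable_def field_differentiable_def)
  qed
  moreover have "continuous_on U (pderiv_dir i g) \<longleftrightarrow> continuous_on U (pderiv_dir i h)" for i
    by (rule continuous_on_cong[OF refl], rule pderiv_dir_cong[OF U]) (use eq in auto)
  moreover have "continuous_on U g \<longleftrightarrow> continuous_on U h"
    by (rule continuous_on_cong[OF refl eq])
  ultimately show ?thesis unfolding C1_on_def by auto
qed

lemma C1_onI:
  assumes D: "\<And>z. z \<in> U \<Longrightarrow> (g has_derivative D z) (at z)"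
    and c: "\<And>i. i \<in> Basis \<Longrightarrow> continuous_on U (\<lambda>z. D z i)"
  shows "C1_on U g"
proof -
  have "continuous_on U g"
    by (rule has_derivative_continuous_on[OF has_derivative_at_withinI[OF D]])
  moreover have "(\<lambda>s. g (z + s *\<^sub>R i)) differentiable (at 0)" if "z \<in> U" for z i
    using pderiv_dir_eq(1)[OF D[OF that]] real_differentiable_def by blast
  moreover have "continuous_on U (pderiv_dir i g)" if "i \<in> Basis" for i
    using c[OF that] by (rule continuous_on_eq) (simp add: pderiv_dir_eq(2)[OF D])
  ultimately show ?thesis by (auto simp: C1_on_def)
qed

text \<open>All test functions separate into a function of time and a function of the radius.\<close>
definition radial_test :: "(real \<Rightarrow> real) \<Rightarrow> (real \<Rightarrow> real) \<Rightarrow> real \<times> 'a::euclidean_space \<Rightarrow> real" where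
  "radial_test \<eta> F z = \<eta> (fst z) * F (norm (snd z))"

lemma radial_test_has_derivative:
  fixes z :: "real \<times> 'a::euclidean_space"
  assumes "(\<eta> has_real_derivative \<eta>') (at (fst z))" "(F has_real_derivative F') (at (norm (snd z)))"
    and "snd z \<noteq> 0"
  shows "(radial_test \<eta> F has_derivative
    (\<lambda>h. \<eta>' * fst h * F (norm (snd z))
       + \<eta> (fst z) * (F' / norm (snd z) * (snd z \<bullet> snd h)))) (at z)"
proof -
  have n: "((\<lambda>z. norm (snd z)) has_derivative (\<lambda>h. (snd z \<bullet> snd h) / norm (snd z))) (at z)"
    using has_derivative_compose[OF has_derivative_snd[OF has_derivative_ident, of "at z"]
        has_derivative_norm[OF assms(3)]]
    by (simp add: sgn_div_norm inner_commute divide_inverse mult.commute)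
  have f: "((\<lambda>z. \<eta> (fst z)) has_derivative (\<lambda>h. \<eta>' * fst h)) (at z)"
    using has_derivative_compose[OF has_derivative_fst[OF has_derivative_ident, of "at z"]
        assms(1)[unfolded has_field_derivative_def]] by simp
  have g: "((\<lambda>z. F (norm (snd z))) has_derivative (\<lambda>h. F' * ((snd z \<bullet> snd h) / norm (snd z)))) (at z)"
    using has_derivative_compose[OF n assms(2)[unfolded has_field_derivative_def]] by simp
  show ?thesis unfolding radial_test_def[abs_def]
    by (rule has_derivative_eq_rhs[OF has_derivative_mult[OF f g]]) (auto simp: algebra_simps)
qed

text \<open>An open neighbourhood of the cylinder on which every radial factor is smooth. It extends beyond the
outer sphere, where the normal derivative is a two-sided derivative.\<close>
abbreviation exterior :: "(real \<times> 'a::euclidean_space) set" where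
  "exterior \<equiv> {z. 1 < norm (snd z)}"

lemma open_exterior: "open (exterior :: (real \<times> 'a::euclidean_space) set)"
  by (intro open_Collect_less continuous_intros)

context
  fixes \<eta> \<eta>1 \<eta>2 F F1 F2 :: "real \<Rightarrow> real"
  assumes sd_\<eta>: "second_derivs UNIV \<eta> \<eta>1 \<eta>2" and sd_F: "second_derivs {1<..} F F1 F2"
begin

private lemma \<eta>: "(\<eta> has_real_derivative \<eta>1 t) (at t)" "(\<eta>1 has_real_derivative \<eta>2 t) (at t)"
  using sd_\<eta> by (simp_all add: second_derivs_def)

private lemma F: "r > 1 \<Longrightarrow> (F has_real_derivative F1 r) (at r)"
    "r > 1 \<Longrightarrow> (F1 has_real_derivative F2 r) (at r)"
  using sd_F by (simp_all add: second_derivs_def)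

private lemma cont:
  "continuous_on exterior (\<lambda>z. \<eta> (fst z))" "continuous_on exterior (\<lambda>z. \<eta>1 (fst z))"
  "continuous_on exterior (\<lambda>z. \<eta>2 (fst z))"
  "continuous_on exterior (\<lambda>z. F (norm (snd z)))"
  "continuous_on exterior (\<lambda>z. F1 (norm (snd z)))"
  "continuous_on exterior (\<lambda>z. F2 (norm (snd z)))"
  by (rule continuous_on_compose2[OF _ continuous_on_fst[OF continuous_on_id]],
      rule second_derivs_continuous[OF sd_\<eta>], simp)+
    (rule continuous_on_compose2[OF _ continuous_on_norm[OF continuous_on_snd[OF continuous_on_id]]],
      rule second_derivs_continuous[OF sd_F], auto)+

private lemma pderiv_dir_radial_test:
  fixes z :: "real \<times> 'a::euclidean_space"
  assumes "z \<in> exterior"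
  shows "pderiv_dir v (radial_test \<eta> F) z = \<eta>1 (fst z) * fst v * F (norm (snd z))
       + \<eta> (fst z) * (F1 (norm (snd z)) / norm (snd z) * (snd z \<bullet> snd v))"
  by (rule pderiv_dir_eq(2)[OF radial_test_has_derivative]) (use \<eta> F assms in auto)

private lemma C1_radial_test: "C1_on (exterior :: (real \<times> 'a::euclidean_space) set) (radial_test \<eta> F)"
proof (rule C1_onI)
  fix z :: "real \<times> 'a" assume "z \<in> exterior"
  then show "((radial_test \<eta> F) has_derivative (\<lambda>h. \<eta>1 (fst z) * fst h * F (norm (snd z))
       + \<eta> (fst z) * (F1 (norm (snd z)) / norm (snd z) * (snd z \<bullet> snd h)))) (at z)"
    by (intro radial_test_has_derivative) (use \<eta> F in auto)
next
  fix i :: "real \<times> 'a"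
  show "continuous_on exterior (\<lambda>z. \<eta>1 (fst z) * fst i * F (norm (snd z))
       + \<eta> (fst z) * (F1 (norm (snd z)) / norm (snd z) * (snd z \<bullet> snd i)))"
    by (intro continuous_intros cont) auto
qed

private lemma space_deriv_has_derivative:
  fixes z :: "real \<times> 'a::euclidean_space"
  assumes z: "z \<in> exterior"
  defines "r \<equiv> norm (snd z)"
  shows "((\<lambda>z. radial_test \<eta> (\<lambda>r. F1 r / r) z * (snd z \<bullet> b)) has_derivative
    (\<lambda>h. radial_test \<eta> (\<lambda>r. F1 r / r) z * (snd h \<bullet> b) +
      (\<eta>1 (fst z) * fst h * (F1 r / r)
       + \<eta> (fst z) * ((F2 r * r - F1 r) / (r * r) / r * (snd z \<bullet> snd h))) * (snd z \<bullet> b))) (at z)"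
proof -
  have r: "r > 1" using z by (simp add: r_def)
  have "((\<lambda>r. F1 r / r) has_real_derivative (F2 r * r - F1 r) / (r * r)) (at r)"
    using F(2)[OF r] r by (auto intro!: derivative_eq_intros)
  then have a: "(radial_test \<eta> (\<lambda>r. F1 r / r) has_derivative
    (\<lambda>h. \<eta>1 (fst z) * fst h * (F1 (norm (snd z)) / norm (snd z))
       + \<eta> (fst z) * ((F2 r * r - F1 r) / (r * r) / norm (snd z) * (snd z \<bullet> snd h)))) (at z)"
    using r by (intro radial_test_has_derivative \<eta>) (auto simp: r_def)
  have b: "((\<lambda>z. snd z \<bullet> b) has_derivative (\<lambda>h. snd h \<bullet> b)) (at z)"
    by (auto intro!: derivative_eq_intros)
  show ?thesis using has_derivative_mult[OF a b] by (simp add: r_def)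
qed

lemma C2_on_radial_test: "C2_on (exterior :: (real \<times> 'a::euclidean_space) set) (radial_test \<eta> F)"
  unfolding C2_on_def
proof (intro conjI ballI C1_radial_test)
  fix i :: "real \<times> 'a" assume "i \<in> Basis"
  then consider "i = (1, 0)" | b where "b \<in> Basis" "i = (0, b)"
    by (auto simp: Basis_prod_def)
  then show "C1_on exterior (pderiv_dir i (radial_test \<eta> F))"
  proof cases
    case 1
    have "C1_on exterior (radial_test \<eta>1 F :: real \<times> 'a \<Rightarrow> real)"
    proof (rule C1_onI)
      fix z :: "real \<times> 'a" assume "z \<in> exterior"
      then show "(radial_test \<eta>1 F has_derivative (\<lambda>h. \<eta>2 (fst z) * fst h * F (norm (snd z))
           + \<eta>1 (fst z) * (F1 (norm (snd z)) / norm (snd z) * (snd z \<bullet> snd h)))) (at z)"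
        by (intro radial_test_has_derivative) (use \<eta> F in auto)
    qed (intro continuous_intros cont; auto)
    then show ?thesis
      by (subst C1_on_cong[OF open_exterior, where h="radial_test \<eta>1 F"])
        (use 1 in \<open>auto simp: pderiv_dir_radial_test radial_test_def\<close>)
  next
    case 2
    have "C1_on exterior (\<lambda>z::real \<times> 'a. radial_test \<eta> (\<lambda>r. F1 r / r) z * (snd z \<bullet> b))"
      by (rule C1_onI, erule space_deriv_has_derivative)
        (unfold radial_test_def, intro continuous_intros cont; auto)
    then show ?thesis
      by (subst C1_on_cong[OF open_exterior, where h="\<lambda>z. radial_test \<eta> (\<lambda>r. F1 r / r) z * (snd z \<bullet> b)"])
        (use 2 in \<open>auto simp: pderiv_dir_radial_test radial_test_def\<close>)
  qed
qed

lemma time_deriv_radial_test: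
  fixes z :: "real \<times> 'a::euclidean_space"
  assumes "z \<in> exterior"
  shows "time_deriv (radial_test \<eta> F) z = radial_test \<eta>1 F z"
  using pderiv_dir_radial_test[OF assms] by (simp add: time_deriv_def radial_test_def)

lemma normal_deriv_radial_test:
  fixes z :: "real \<times> 'a::euclidean_space"
  assumes "z \<in> exterior"
  shows "normal_deriv (radial_test \<eta> F) z = radial_test \<eta> F1 z"
  using pderiv_dir_radial_test[OF assms] assms
  by (auto simp: normal_deriv_def radial_test_def dot_square_norm power2_eq_square)

lemma time_deriv2_radial_test:
  fixes z :: "real \<times> 'a::euclidean_space"
  assumes z: "z \<in> exterior"
  shows "time_deriv (time_deriv (radial_test \<eta> F)) z = radial_test \<eta>2 F z"
proof -
  have "time_deriv (time_deriv (radial_test \<eta> F)) z = pderiv_dir (1, 0) (radial_test \<eta>1 F) z"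
    unfolding time_deriv_def[of "time_deriv _"]
    by (rule pderiv_dir_cong[OF open_exterior z time_deriv_radial_test])
  also have "\<dots> = \<eta>2 (fst z) * fst (1::real, 0::'a) * F (norm (snd z))
       + \<eta>1 (fst z) * (F1 (norm (snd z)) / norm (snd z) * (snd z \<bullet> snd (1::real, 0::'a)))"
    by (rule pderiv_dir_eq(2)[OF radial_test_has_derivative]) (use \<eta> F z in auto)
  finally show ?thesis by (simp add: radial_test_def)
qed

lemma laplacian_radial_test:
  fixes z :: "real \<times> 'a::euclidean_space"
  assumes z: "z \<in> exterior"
  shows "laplacian (radial_test \<eta> F) z = radial_test \<eta> (\<lambda>r. F2 r + (real DIM('a) - 1) / r * F1 r) z"
proof -
  define r where "r = norm (snd z)"
  have r: "r > 1" using z by (simp add: r_def)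
  have "pderiv_dir (0, b) (pderiv_dir (0, b) (radial_test \<eta> F)) z =
      \<eta> (fst z) * (F1 r / r) + \<eta> (fst z) * ((F2 r * r - F1 r) / (r * r) / r) * (snd z \<bullet> b)\<^sup>2"
    if "b \<in> Basis" for b
  proof -
    have "pderiv_dir (0, b) (pderiv_dir (0, b) (radial_test \<eta> F)) z
        = pderiv_dir (0, b) (\<lambda>z. radial_test \<eta> (\<lambda>r. F1 r / r) z * (snd z \<bullet> b)) z"
      by (rule pderiv_dir_cong[OF open_exterior z])
        (auto simp: pderiv_dir_radial_test radial_test_def)
    also have "\<dots> = radial_test \<eta> (\<lambda>r. F1 r / r) z * (b \<bullet> b) +
       \<eta> (fst z) * ((F2 r * r - F1 r) / (r * r) / r * (snd z \<bullet> b)) * (snd z \<bullet> b)"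
      by (subst pderiv_dir_eq(2)[OF space_deriv_has_derivative[OF z]]) (simp add: r_def)
    finally show ?thesis using that by (simp add: radial_test_def r_def power2_eq_square)
  qed
  then have "laplacian (radial_test \<eta> F) z = (\<Sum>b\<in>Basis. \<eta> (fst z) * (F1 r / r) +
      \<eta> (fst z) * ((F2 r * r - F1 r) / (r * r) / r) * (snd z \<bullet> b)\<^sup>2)"
    by (simp add: laplacian_def)
  also have "\<dots> = real DIM('a) * (\<eta> (fst z) * (F1 r / r)) +
      \<eta> (fst z) * ((F2 r * r - F1 r) / (r * r) / r) * (\<Sum>b\<in>Basis. (snd z \<bullet> b)\<^sup>2)"
    by (simp add: sum.distrib sum_distrib_left)
  also have "(\<Sum>b\<in>Basis. (snd z \<bullet> b)\<^sup>2) = r * r"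
    using euclidean_inner[of "snd z" "snd z"]
    by (simp add: r_def power2_eq_square dot_square_norm)
  finally show ?thesis
    using r by (simp add: radial_test_def[of _ _ z] flip: r_def) (simp add: field_simps)
qed

end

section \<open>Integral estimates\<close>

lemma cylinder_infinity: "cylinder \<infinity> = {0<..} \<times> shell"
  by (auto simp: cylinder_def)

lemma shell_eq: "(shell :: 'a::euclidean_space set) = cball 0 2 - cball 0 1"
  by (auto simp: shell_def)

lemma sets_shell [measurable]: "(shell :: 'a::euclidean_space set) \<in> sets borel"
  unfolding shell_eq by simp

lemma sets_cylinder: "(cylinder \<infinity> :: (real \<times> 'a::euclidean_space) set) \<in> sets borel"
  unfolding cylinder_infinity by (intro borel_Times) auto

text \<open>On the compact set \<open>K\<close> that carries \<open>h\<close>, the factor \<open>h\<close> is bounded and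
\<open>\<bar>u\<bar> \<le> 1 + \<bar>u\<bar> powr p\<close>.\<close>
lemma Lp_loc_set_integrable_mult:
  fixes u h :: "'b::euclidean_space \<Rightarrow> real"
  assumes u: "Lp_loc p Q u" and p: "p \<ge> 1" and Q: "Q \<in> sets lebesgue"
    and h: "continuous_on Q h" and K: "compact K" "K \<subseteq> Q" "\<And>z. z \<in> Q - K \<Longrightarrow> h z = 0"
  shows "set_integrable lebesgue Q (\<lambda>z. u z * h z)"
    and "set_integrable lebesgue Q (\<lambda>z. \<bar>u z\<bar> powr p * h z)"
proof -
  obtain M where M: "M \<ge> 0" "\<And>z. z \<in> K \<Longrightarrow> \<bar>h z\<bar> \<le> M"
  proof -
    have "bounded (h ` K)"
      by (intro compact_imp_bounded compact_continuous_image continuous_on_subset[OF h] K)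
    then obtain B where "\<And>z. z \<in> K \<Longrightarrow> \<bar>h z\<bar> \<le> B" by (auto simp: bounded_iff)
    then show thesis by (intro that[of "\<bar>B\<bar>"]) fastforce+
  qed
  have um: "u \<in> borel_measurable (lebesgue_on Q)" using u by (simp add: Lp_loc_def)
  have hm: "h \<in> borel_measurable (lebesgue_on Q)"
    by (rule continuous_imp_measurable_on_sets_lebesgue[OF h Q])
  have "integrable lebesgue (\<lambda>z. indicator K z *\<^sub>R \<bar>u z\<bar> powr p)"
    using u K by (simp add: Lp_loc_def set_integrable_def)
  moreover have "integrable lebesgue (\<lambda>z. indicator K z :: real)"
    using lmeasurable_compact[OF K(1)]
    by (intro integrable_real_indicator) (auto simp: fmeasurable_def)
  ultimately have "integrable lebesgue (\<lambda>z. M * (indicator K z + indicator K z *\<^sub>R \<bar>u z\<bar> powr p))"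
    by (intro Bochner_Integration.integrable_add integrable_mult_right)
  note dom = Bochner_Integration.integrable_bound[OF this]
  have bd: "\<bar>u z\<bar> \<le> 1 + \<bar>u z\<bar> powr p" for z
  proof (cases "\<bar>u z\<bar> \<le> 1")
    case False
    then have "\<bar>u z\<bar> powr 1 \<le> \<bar>u z\<bar> powr p" using p by (intro powr_mono) auto
    then show ?thesis using False by simp
  qed (auto intro: order_trans)
  have bdI: "norm (indicator Q z *\<^sub>R (a * h z)) \<le>
      norm (M * (indicator K z + indicator K z *\<^sub>R \<bar>u z\<bar> powr p))"
    if "\<bar>a\<bar> \<le> 1 + \<bar>u z\<bar> powr p" for a z
  proof (cases "z \<in> K")
    case True
    have "\<bar>a\<bar> * \<bar>h z\<bar> \<le> (1 + \<bar>u z\<bar> powr p) * M"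
      using that M(2)[OF True] by (intro mult_mono) auto
    then show ?thesis using True M(1) K(2) by (auto simp: indicator_def abs_mult mult.commute)
  next
    case False
    then show ?thesis using K(3)[of z] by (auto simp: indicator_def)
  qed
  show "set_integrable lebesgue Q (\<lambda>z. u z * h z)"
    unfolding set_integrable_def
  proof (rule dom)
    show "(\<lambda>z. indicator Q z *\<^sub>R (u z * h z)) \<in> borel_measurable lebesgue"
      using borel_measurable_times[OF um hm] Q
      by (simp add: borel_measurable_restrict_space_iff mult.commute)
    show "AE z in lebesgue. norm (indicator Q z *\<^sub>R (u z * h z)) \<le>
      norm (M * (indicator K z + indicator K z *\<^sub>R \<bar>u z\<bar> powr p))"
      by (intro AE_I2 bdI bd)
  qed
  show "set_integrable lebesgue Q (\<lambda>z. \<bar>u z\<bar> powr p * h z)"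
    unfolding set_integrable_def
  proof (rule dom)
    have "(\<lambda>z. \<bar>u z\<bar> powr p) \<in> borel_measurable (lebesgue_on Q)" using um by measurable
    from borel_measurable_times[OF this hm]
    show "(\<lambda>z. indicator Q z *\<^sub>R (\<bar>u z\<bar> powr p * h z)) \<in> borel_measurable lebesgue"
      using Q by (simp add: borel_measurable_restrict_space_iff mult.commute)
    show "AE z in lebesgue. norm (indicator Q z *\<^sub>R (\<bar>u z\<bar> powr p * h z)) \<le>
      norm (M * (indicator K z + indicator K z *\<^sub>R \<bar>u z\<bar> powr p))"
      by (intro AE_I2 bdI) auto
  qed
qed

text \<open>Young's inequality for the factors \<open>\<bar>u\<bar> * a powr (1 / p)\<close> and \<open>k\<close>. The nonlinear term absorbs the
first one, and what remains no longer depends on \<open>u\<close>.\<close>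
lemma Young_absorb:
  fixes p q u a g k :: real
  assumes p: "p > 1" and q: "1 / p + 1 / q = 1" and a: "a \<ge> 0" and k: "k \<ge> 0"
    and g: "\<bar>g\<bar> \<le> a powr (1 / p) * k"
  shows "u * g - \<bar>u\<bar> powr p * a \<le> k powr q"
proof -
  have q1: "q > 1"
  proof -
    have "1 / q = (p - 1) / p" using p q by (simp add: field_simps)
    then have "q = p / (p - 1)" by (metis inverse_divide inverse_eq_divide inverse_inverse_eq)
    then show ?thesis using p by simp
  qed
  have "u * g \<le> \<bar>u\<bar> * \<bar>g\<bar>" by (metis abs_ge_self abs_mult)
  also have "\<dots> \<le> \<bar>u\<bar> * (a powr (1 / p) * k)" using g by (intro mult_left_mono) auto
  also have "\<dots> = (\<bar>u\<bar> * a powr (1 / p)) * k" by simp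
  also have "\<dots> \<le> (\<bar>u\<bar> * a powr (1 / p)) powr p / p + k powr q / q"
    using p q1 q k by (intro Youngs_inequality) auto
  also have "(\<bar>u\<bar> * a powr (1 / p)) powr p = \<bar>u\<bar> powr p * a"
    using p a by (simp add: powr_mult powr_powr)
  also have "\<bar>u\<bar> powr p * a / p \<le> \<bar>u\<bar> powr p * a"
  proof -
    have "0 \<le> \<bar>u\<bar> powr p * a" using a by simp
    from divide_left_mono[OF less_imp_le[OF p] this] p show ?thesis by simp
  qed
  also have "k powr q / q \<le> k powr q" using divide_left_mono[OF less_imp_le[OF q1], of "k powr q"] q1 by simp
  finally show ?thesis by simp
qed

text \<open>The test function method in abstract form: \<open>a\<close> is the weighted test function of the nonlinear term
and \<open>g\<close> the adjoint operator applied to the test function. The boundary term \<open>B\<close> gets a bound in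
which the solution does not occur.\<close>
lemma boundary_term_le:
  fixes u a g k :: "'b::euclidean_space \<Rightarrow> real"
  assumes u: "Lp_loc p Q u" and Q: "Q \<in> sets lebesgue"
    and p: "p > 1" and q: "1 / p + 1 / q = 1"
    and c: "continuous_on Q a" "continuous_on Q g"
    and K: "compact K" "K \<subseteq> Q" "\<And>z. z \<in> Q - K \<Longrightarrow> a z = 0" "\<And>z. z \<in> Q - K \<Longrightarrow> g z = 0"
    and nn: "\<And>z. z \<in> Q \<Longrightarrow> a z \<ge> 0" "\<And>z. z \<in> Q \<Longrightarrow> k z \<ge> 0"
    and bd: "\<And>z. z \<in> Q \<Longrightarrow> \<bar>g z\<bar> \<le> a z powr (1 / p) * k z"
    and k: "set_integrable lebesgue Q (\<lambda>z. k z powr q)"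
    and B: "(LINT z:Q|lebesgue. \<bar>u z\<bar> powr p * a z) + B \<le> (LINT z:Q|lebesgue. u z * g z)"
  shows "B \<le> (LINT z:Q|lebesgue. k z powr q)"
proof -
  note i1 = Lp_loc_set_integrable_mult(1)[OF u _ Q c(2) K(1,2,4)]
  note i2 = Lp_loc_set_integrable_mult(2)[OF u _ Q c(1) K(1,2,3)]
  have "B \<le> (LINT z:Q|lebesgue. u z * g z - \<bar>u z\<bar> powr p * a z)"
    using B p set_integral_diff(2)[OF i1 i2] by simp
  also have "\<dots> \<le> (LINT z:Q|lebesgue. k z powr q)"
    using p q nn bd by (intro set_integral_mono set_integral_diff(1) i1 i2 k Young_absorb[of p q]) auto
  finally show ?thesis .
qed

definition dyadic_ring :: "nat \<Rightarrow> 'a::euclidean_space set" where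
  "dyadic_ring j = {x. (1/2) ^ Suc j \<le> norm x - 1 \<and> norm x - 1 \<le> (1/2) ^ j}"

text \<open>A step function that dominates both \<open>1\<close> and, on the region where the spatial cutoff varies,
\<open>1 / (norm x - 1)\<close>. Its integral needs only volumes of balls, no polar coordinates.\<close>
definition dyadic_weight :: "nat \<Rightarrow> 'a::euclidean_space \<Rightarrow> real" where
  "dyadic_weight n x = 1 + (\<Sum>j=1..n. 2 ^ Suc j * indicator (dyadic_ring j) x)"

lemma dyadic_weight_ge_1: "dyadic_weight n x \<ge> 1"
  by (simp add: dyadic_weight_def sum_nonneg)

lemma inverse_le_dyadic_weight:
  fixes x :: "'a::euclidean_space"
  assumes n: "n \<ge> 1" and x: "(1/2) ^ Suc n \<le> norm x - 1" "norm x - 1 \<le> 1/2"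
  shows "1 / (norm x - 1) \<le> dyadic_weight n x"
proof -
  from n x(1) have "\<exists>j\<in>{1..n}. x \<in> dyadic_ring j"
  proof (induction n rule: nat_induct_at_least)
    case base
    then show ?case using x(2) by (auto simp: dyadic_ring_def)
  next
    case (Suc n)
    show ?case
    proof (cases "(1/2) ^ Suc n \<le> norm x - 1")
      case True
      from Suc.IH[OF this] show ?thesis by auto
    next
      case False
      with Suc.prems have "x \<in> dyadic_ring (Suc n)" by (auto simp: dyadic_ring_def)
      then show ?thesis by (intro bexI[of _ "Suc n"]) auto
    qed
  qed
  then obtain j where j: "j \<in> {1..n}" "x \<in> dyadic_ring j" by blast
  have "(1/2) ^ Suc j \<le> norm x - 1" using j by (simp add: dyadic_ring_def)
  moreover have "0 < (1/2::real) ^ Suc j" by simp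
  ultimately have "1 / (norm x - 1) \<le> 1 / (1/2) ^ Suc j" by (intro divide_left_mono mult_pos_pos) linarith+
  also have "\<dots> = 2 ^ Suc j * indicator (dyadic_ring j) x"
    using j by (simp add: power_divide)
  also have "\<dots> \<le> (\<Sum>j=1..n. 2 ^ Suc j * indicator (dyadic_ring j) x)"
    by (rule member_le_sum[OF j(1)]) auto
  finally show ?thesis by (simp add: dyadic_weight_def)
qed

lemma power_diff_le_Lipschitz:
  fixes x y :: real
  assumes "0 \<le> x" "x \<le> y" "y \<le> 2"
  shows "y ^ N - x ^ N \<le> real N * 2 ^ N * (y - x)"
proof (induction N)
  case (Suc N)
  have "y ^ Suc N - x ^ Suc N = y * (y ^ N - x ^ N) + x ^ N * (y - x)"
    by (simp add: algebra_simps)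
  also have "\<dots> \<le> 2 * (real N * 2 ^ N * (y - x)) + 2 ^ N * (y - x)"
    using assms Suc.IH by (intro add_mono mult_mono power_mono) (auto simp: power_mono)
  also have "\<dots> \<le> real (Suc N) * 2 ^ Suc N * (y - x)"
    using assms by (simp add: algebra_simps)
  finally show ?case .
qed simp

text \<open>The volume of a ring around the unit sphere is at most proportional to its thickness, and the
\<open>j\<close>-th ring has thickness \<open>(1/2) ^ Suc j\<close>. Hence all rings contribute equally to the integral of
\<open>dyadic_weight\<close>, up to a constant.\<close>
lemma measure_dyadic_ring:
  shows "(dyadic_ring j :: 'a::euclidean_space set) \<in> sets borel" "bounded (dyadic_ring j :: 'a set)"
    and "2 ^ Suc j * measure lborel (dyadic_ring j :: 'a set)
      \<le> unit_ball_vol (real DIM('a)) * (real DIM('a) * 2 ^ DIM('a))"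
proof -
  define a :: real where "a = (1/2) ^ Suc j"
  have a: "0 < a" "2 * a \<le> 1" "(1/2) ^ j = 2 * a" "2 ^ Suc j * a = 1"
    using power_le_one[of "1/2::real" j] by (auto simp: a_def power_divide)
  have eq: "(dyadic_ring j :: 'a set) = cball 0 (1 + 2 * a) - ball 0 (1 + a)"
    using a by (auto simp: dyadic_ring_def simp flip: a_def)
  show "(dyadic_ring j :: 'a set) \<in> sets borel" "bounded (dyadic_ring j :: 'a set)"
    unfolding eq by (auto intro: bounded_subset[OF bounded_cball])
  have "measure lborel (dyadic_ring j :: 'a set)
      = measure lborel (cball (0::'a) (1 + 2 * a)) - measure lborel (ball (0::'a) (1 + a))"
    unfolding eq using a
    by (intro measure_Diff) (use emeasure_lborel_cball_finite[of "0::'a" "1 + 2 * a"] in auto)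
  also have "\<dots> = unit_ball_vol (real DIM('a)) * ((1 + 2 * a) ^ DIM('a) - (1 + a) ^ DIM('a))"
    using a by (simp add: content_cball content_ball right_diff_distrib)
  also have "\<dots> \<le> unit_ball_vol (real DIM('a)) * (real DIM('a) * 2 ^ DIM('a) * ((1 + 2 * a) - (1 + a)))"
    using a by (intro mult_left_mono power_diff_le_Lipschitz) auto
  finally have "2 ^ Suc j * measure lborel (dyadic_ring j :: 'a set) \<le>
     2 ^ Suc j * (unit_ball_vol (real DIM('a)) * (real DIM('a) * 2 ^ DIM('a) * a))"
    by (intro mult_left_mono) auto
  also have "\<dots> = unit_ball_vol (real DIM('a)) * (real DIM('a) * 2 ^ DIM('a)) * (2 ^ Suc j * a)"
    by (simp only: ac_simps)
  finally show "2 ^ Suc j * measure lborel (dyadic_ring j :: 'a set)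
      \<le> unit_ball_vol (real DIM('a)) * (real DIM('a) * 2 ^ DIM('a))"
    by (simp only: a mult_1_right)
qed

lemma set_lebesgue_integral_indicator_Times:
  fixes S :: "'a::euclidean_space set"
  assumes S: "S \<in> sets borel" "bounded S" "{a..b} \<times> S \<subseteq> Q" and ab: "a \<le> b"
  shows "set_integrable lebesgue Q (indicator ({a..b} \<times> S) :: real \<times> 'a \<Rightarrow> real)"
    and "(LINT z:Q|lebesgue. indicator ({a..b} \<times> S) z) = (b - a) * measure lborel S"
proof -
  have fin: "emeasure lborel S < \<infinity>"
    using S(2) by (rule emeasure_bounded_finite)
  have e: "emeasure lborel ({a..b} \<times> S) = ennreal (b - a) * emeasure lborel S"
    using S(1) ab by (subst lborel_prod[symmetric]) (simp add: lborel.emeasure_pair_measure_Times)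
  have b: "{a..b} \<times> S \<in> sets borel" using S by (intro borel_Times) auto
  have eq: "(\<lambda>z. indicator Q z *\<^sub>R indicator ({a..b} \<times> S) z) = (indicator ({a..b} \<times> S) :: _ \<Rightarrow> real)"
    using S(3) by (auto simp: fun_eq_iff indicator_def)
  have m: "measure lebesgue ({a..b} \<times> S) = (b - a) * measure lborel S"
    using b e ab by (simp add: measure_def enn2real_mult)
  show "set_integrable lebesgue Q (indicator ({a..b} \<times> S) :: real \<times> 'a \<Rightarrow> real)"
    unfolding set_integrable_def eq using b e fin
    by (intro integrable_real_indicator) (auto simp: ennreal_mult_less_top)
  show "(LINT z:Q|lebesgue. indicator ({a..b} \<times> S) z) = (b - a) * measure lborel S"
    unfolding set_lebesgue_integral_def eq m[symmetric] using b by simp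
qed

text \<open>One factor \<open>n\<close> is the length of the time interval, the other the number of rings.\<close>
lemma dyadic_weight_integral:
  obtains c :: real where "c > 0"
    "\<And>n. n \<ge> 1 \<Longrightarrow> set_integrable lebesgue (cylinder \<infinity>)
        (\<lambda>z::real \<times> 'a::euclidean_space. indicator {real n..2 * real n} (fst z) * dyadic_weight n (snd z))"
    "\<And>n. n \<ge> 1 \<Longrightarrow> (LINT z:(cylinder \<infinity> :: (real \<times> 'a) set)|lebesgue.
        indicator {real n..2 * real n} (fst z) * dyadic_weight n (snd z)) \<le> c * (real n)\<^sup>2"
proof -
  let ?Q = "cylinder \<infinity> :: (real \<times> 'a) set"
  define c1 where "c1 = unit_ball_vol (real DIM('a)) * (real DIM('a) * 2 ^ DIM('a))"
  define c0 where "c0 = measure lborel (shell :: 'a set)"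
  have c: "c0 \<ge> 0" "c1 > 0" by (auto simp: c0_def c1_def)
  show thesis
  proof (rule that[of "c0 + c1"])
    fix n :: nat assume n: "n \<ge> 1"
    let ?I = "{real n..2 * real n}"
    define f where "f z = indicator ?I (fst z) * dyadic_weight n (snd z)" for z :: "real \<times> 'a"
    define g :: "real \<times> 'a \<Rightarrow> real" where "g z = indicator (?I \<times> shell) z +
      (\<Sum>j=1..n. 2 ^ Suc j * indicator (?I \<times> dyadic_ring j) z)" for z :: "real \<times> 'a"
    have sub: "(dyadic_ring j :: 'a set) \<subseteq> shell" for j
    proof -
      have "0 < (1/2::real) ^ Suc j" "(1/2::real) ^ j \<le> 1" by (auto intro: power_le_one)
      then show ?thesis unfolding dyadic_ring_def shell_def by (smt (verit) Collect_mono)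
    qed
    have I: "?I \<times> shell \<subseteq> ?Q" using n by (auto simp: cylinder_infinity)
    have J: "?I \<times> dyadic_ring j \<subseteq> ?Q" for j using I sub[of j] by blast
    have bs: "bounded (shell :: 'a set)" unfolding shell_eq by (rule bounded_subset[OF bounded_cball]) auto
    note s = set_lebesgue_integral_indicator_Times[OF sets_shell bs I]
    note r = set_lebesgue_integral_indicator_Times[OF measure_dyadic_ring(1,2) J]
    have fg: "f z = g z" if "z \<in> ?Q" for z
      using that by (auto simp: f_def g_def dyadic_weight_def cylinder_infinity indicator_def sum_distrib_left)
    have si: "set_integrable lebesgue ?Q (\<lambda>z. 2 ^ Suc j * indicator (?I \<times> dyadic_ring j) z :: real)" for j
      by (intro set_integrable_mult_right r(1)) simp
    have ss: "set_integrable lebesgue ?Q (\<lambda>z. \<Sum>j=1..n. 2 ^ Suc j * indicator (?I \<times> dyadic_ring j) z :: real)"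
      using si unfolding set_integrable_def scaleR_sum_right
      by (intro Bochner_Integration.integrable_sum)
    have gi: "set_integrable lebesgue ?Q g"
      unfolding g_def by (intro set_integral_add(1) s(1) ss) simp
    have "set_integrable lebesgue ?Q f \<longleftrightarrow> set_integrable lebesgue ?Q g"
      by (rule set_integrable_cong[OF refl refl fg])
    with gi show "set_integrable lebesgue ?Q (\<lambda>z. indicator ?I (fst z) * dyadic_weight n (snd z))"
      by (simp add: f_def[abs_def])
    have "(LINT z:?Q|lebesgue. f z) = (LINT z:?Q|lebesgue. g z)"
      using fg sets_cylinder by (intro set_lebesgue_integral_cong) auto
    also have "\<dots> = (LINT z:?Q|lebesgue. indicator (?I \<times> shell) z) +
        (LINT z:?Q|lebesgue. (\<Sum>j=1..n. 2 ^ Suc j * indicator (?I \<times> dyadic_ring j) z :: real))"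
      unfolding g_def by (intro set_integral_add(2) s(1) ss) simp
    also have "(LINT z:?Q|lebesgue. (\<Sum>j=1..n. 2 ^ Suc j * indicator (?I \<times> dyadic_ring j) z :: real)) =
        (\<Sum>j=1..n. (LINT z:?Q|lebesgue. 2 ^ Suc j * indicator (?I \<times> dyadic_ring j) z))"
      using si unfolding set_lebesgue_integral_def set_integrable_def scaleR_sum_right
      by (intro Bochner_Integration.integral_sum)
    also have "\<dots> = (\<Sum>j=1..n. real n * (2 ^ Suc j * measure lborel (dyadic_ring j :: 'a set)))"
      by (rule sum.cong[OF refl]) (simp only: set_integral_mult_right r(2), simp)
    also have "\<dots> \<le> (\<Sum>j=1..n. real n * c1)"
      unfolding c1_def by (intro sum_mono mult_left_mono measure_dyadic_ring(3)) auto
    also have "\<dots> = c1 * (real n)\<^sup>2" by (simp add: power2_eq_square)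
    also have "(LINT z:?Q|lebesgue. indicator (?I \<times> shell) z) = c0 * real n"
      by (simp add: s(2) c0_def)
    also have "c0 * real n \<le> c0 * (real n)\<^sup>2"
      using c n by (intro mult_left_mono self_le_power) auto
    finally show "(LINT z:?Q|lebesgue. indicator ?I (fst z) * dyadic_weight n (snd z)) \<le> (c0 + c1) * (real n)\<^sup>2"
      by (simp add: f_def algebra_simps)
  qed (use c in auto)
qed

text \<open>The cone over the whole sphere lies in a ball.\<close>
lemma finite_measure_surface_measure:
  assumes R: "R > 0"
  shows "finite_measure (surface_measure R :: 'a::euclidean_space measure)"
proof (rule finite_measureI)
  have "{s *\<^sub>R x | s x. 0 < s \<and> s < 1 \<and> x \<in> sphere (0::'a) R} \<subseteq> cball 0 R"
    using R by (auto simp: mult_le_cancel_right1)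
  then have "emeasure lborel {s *\<^sub>R x | s x. 0 < s \<and> s < 1 \<and> x \<in> sphere (0::'a) R} < \<infinity>"
    by (intro emeasure_bounded_finite) (rule bounded_subset[OF bounded_cball])
  then show "emeasure (surface_measure R) (space (surface_measure R :: 'a measure)) \<noteq> \<infinity>"
    unfolding space_surface_measure
    by (subst emeasure_surface_measure[OF R]) (auto simp: ennreal_mult_eq_top_iff)
qed

text \<open>Since the surface measure lives on the sphere and \<open>a\<close> vanishes for nonpositive times, the restriction
to the lateral boundary is vacuous and Fubini's theorem applies to the whole product space.\<close>
lemma lat_integral_product:
  fixes f :: "'a::euclidean_space \<Rightarrow> real" and a :: "real \<Rightarrow> real"
  assumes a: "integrable lborel a" "\<And>t. t \<le> 0 \<Longrightarrow> a t = 0"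
    and f: "integrable (surface_measure 2) f"
  shows "lat_integral \<infinity> (\<lambda>z. f (snd z) * a (fst z)) = (LINT t|lborel. a t) * (LINT x|surface_measure 2. f x)"
proof -
  let ?S = "surface_measure 2 :: 'a measure"
  interpret S: finite_measure ?S by (rule finite_measure_surface_measure) simp
  interpret P: pair_sigma_finite lborel ?S
    by (rule pair_sigma_finite.intro) (rule sigma_finite_lborel, unfold_locales)
  let ?g = "\<lambda>z. f (snd z) * a (fst z)"
  have [measurable]: "f \<in> borel_measurable ?S" "a \<in> borel_measurable lborel" using a f by auto
  have int: "integrable (lborel \<Otimes>\<^sub>M ?S) ?g"
  proof (rule P.Fubini_integrable)
    show "?g \<in> borel_measurable (lborel \<Otimes>\<^sub>M ?S)" by measurable
    have "integrable lborel (\<lambda>t. (LINT x|?S. \<bar>f x\<bar>) * \<bar>a t\<bar>)"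
      using a(1) by (intro integrable_mult_right integrable_abs)
    then show "integrable lborel (\<lambda>t. LINT x|?S. norm (?g (t, x)))" by (simp add: abs_mult)
    show "AE t in lborel. integrable ?S (\<lambda>x. ?g (t, x))" using f by auto
  qed
  have "lat_integral \<infinity> ?g = (LINT z|(lborel \<Otimes>\<^sub>M ?S). ?g z)"
    unfolding lat_integral_def set_lebesgue_integral_def
  proof (rule Bochner_Integration.integral_cong[OF refl])
    fix z :: "real \<times> 'a" assume "z \<in> space (lborel \<Otimes>\<^sub>M ?S)"
    then have "snd z \<in> sphere 0 2" by (auto simp: space_pair_measure space_surface_measure)
    then show "indicator (lateral \<infinity>) z *\<^sub>R ?g z = ?g z"
      using a(2)[of "fst z"] by (cases z) (auto simp: lateral_def indicator_def not_less)
  qed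
  also have "\<dots> = (LINT t|lborel. LINT x|?S. ?g (t, x))"
    using P.integral_fst'[OF int] by simp
  also have "\<dots> = (LINT t|lborel. a t) * (LINT x|?S. f x)" by simp
  finally show ?thesis .
qed

section \<open>Nonexistence of global solutions\<close>

text \<open>The conditions on the two factors that make \<open>radial_test \<eta> F\<close> nonnegative, twice continuously
differentiable and compactly supported in the cylinder. The derivatives are required to vanish
together with the functions, so that every differential expression formed from them is supported in
the same compact set.\<close>
definition test_factors :: "(real \<Rightarrow> real) \<Rightarrow> (real \<Rightarrow> real) \<Rightarrow> (real \<Rightarrow> real) \<Rightarrow>
    (real \<Rightarrow> real) \<Rightarrow> (real \<Rightarrow> real) \<Rightarrow> (real \<Rightarrow> real) \<Rightarrow> bool" where
  "test_factors \<eta> \<eta>1 \<eta>2 F F1 F2 \<longleftrightarrow> second_derivs UNIV \<eta> \<eta>1 \<eta>2 \<and> second_derivs {1<..} F F1 F2 \<and>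
     (\<forall>t. 0 \<le> \<eta> t) \<and> (\<forall>r. 1 < r \<and> r \<le> 2 \<longrightarrow> 0 \<le> F r) \<and> integrable lborel \<eta> \<and>
     (\<exists>a b. 0 < a \<and> (\<forall>t. t \<notin> {a..b} \<longrightarrow> \<eta> t = 0 \<and> \<eta>1 t = 0 \<and> \<eta>2 t = 0)) \<and>
     (\<exists>e>0. \<forall>r. 1 < r \<and> r \<le> 1 + e \<longrightarrow> F r = 0 \<and> F1 r = 0 \<and> F2 r = 0)"

text \<open>Compact in the half-open cylinder: it reaches the outer sphere but stays away from the inner one and
from time \<open>0\<close>.\<close>
definition core :: "real \<Rightarrow> real \<Rightarrow> real \<Rightarrow> (real \<times> 'a::euclidean_space) set" where
  "core a b e = {a..b} \<times> (cball 0 2 - ball 0 (1 + e))"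

lemma compact_core:
  assumes "0 < a" "0 < e"
  shows "compact (core a b e)" "core a b e \<subseteq> cylinder \<infinity>"
  using assms by (auto simp: core_def cylinder_infinity shell_def intro!: compact_Times compact_diff)

lemma radial_test_eq_0_off_core:
  fixes z :: "real \<times> 'a::euclidean_space"
  assumes "\<And>t. t \<notin> {a..b} \<Longrightarrow> \<eta> t = 0" "\<And>r. 1 < r \<Longrightarrow> r \<le> 1 + e \<Longrightarrow> F r = 0"
    and "z \<in> cylinder \<infinity> - core a b e"
  shows "radial_test \<eta> F z = 0"
  using assms(1)[of "fst z"] assms(2)[of "norm (snd z)"] assms(3)
  by (cases z) (auto simp: radial_test_def core_def cylinder_infinity shell_def)

lemma continuous_on_radial_test:
  assumes "continuous_on UNIV \<eta>" "continuous_on {1<..} F"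
  shows "continuous_on (cylinder \<infinity>) (radial_test \<eta> F :: real \<times> 'a::euclidean_space \<Rightarrow> real)"
  unfolding radial_test_def
  by (intro continuous_on_mult continuous_on_compose2[OF assms(1), where f=fst]
      continuous_on_compose2[OF assms(2), where f="\<lambda>z. norm (snd z)"] continuous_intros)
    (auto simp: cylinder_infinity shell_def)

lemma cylinder_subset_exterior: "(cylinder \<infinity> :: (real \<times> 'a::euclidean_space) set) \<subseteq> exterior"
  by (auto simp: cylinder_infinity shell_def)

lemma radial_test_set_integrable:
  fixes u :: "real \<times> 'a::euclidean_space \<Rightarrow> real"
  assumes u: "Lp_loc p (cylinder \<infinity>) u" "p \<ge> 1"
    and c: "continuous_on UNIV \<eta>" "continuous_on {1<..} F"
    and z: "0 < a" "\<And>t. t \<notin> {a..b} \<Longrightarrow> \<eta> t = 0" "0 < e" "\<And>r. 1 < r \<Longrightarrow> r \<le> 1 + e \<Longrightarrow> F r = 0"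
  shows "set_integrable lebesgue (cylinder \<infinity>) (\<lambda>z. u z * radial_test \<eta> F z)"
proof (rule Lp_loc_set_integrable_mult(1)[OF u])
  show "(cylinder \<infinity> :: (real \<times> 'a) set) \<in> sets lebesgue" by (simp add: sets_cylinder)
  show "continuous_on (cylinder \<infinity>) (radial_test \<eta> F :: real \<times> 'a \<Rightarrow> real)"
    by (rule continuous_on_radial_test[OF c])
  show "compact (core a b e)" "core a b e \<subseteq> cylinder \<infinity>" by (rule compact_core[OF z(1,3)])+
  show "radial_test \<eta> F z = 0" if "z \<in> cylinder \<infinity> - core a b e" for z :: "real \<times> 'a"
    by (rule radial_test_eq_0_off_core[OF z(2,4) that])
qed

lemma C2_compact_radial_test:
  assumes "test_factors \<eta> \<eta>1 \<eta>2 F F1 F2"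
  shows "C2_compact (cylinder \<infinity>) (radial_test \<eta> F :: real \<times> 'a::euclidean_space \<Rightarrow> real)"
proof -
  have sd: "second_derivs UNIV \<eta> \<eta>1 \<eta>2" "second_derivs {1<..} F F1 F2"
    using assms by (auto simp: test_factors_def)
  obtain a b where a: "0 < a" "\<And>t. t \<notin> {a..b} \<Longrightarrow> \<eta> t = 0"
    using assms unfolding test_factors_def by blast
  obtain e where e: "0 < e" "\<And>r. 1 < r \<Longrightarrow> r \<le> 1 + e \<Longrightarrow> F r = 0"
    using assms unfolding test_factors_def by blast
  show ?thesis
    unfolding C2_compact_def
  proof (intro conjI exI)
    show "open (exterior :: (real \<times> 'a) set)" by (rule open_exterior)
    show "C2_on exterior (radial_test \<eta> F :: real \<times> 'a \<Rightarrow> real)" by (rule C2_on_radial_test[OF sd])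
    show "\<forall>z\<in>cylinder \<infinity> - core a b e. radial_test \<eta> F (z :: real \<times> 'a) = 0"
      by (intro ballI radial_test_eq_0_off_core[where a=a and b=b and e=e]) (use a e in auto)
  qed (rule cylinder_subset_exterior compact_core[OF a(1) e(1)])+
qed

lemma test_factors_derivs:
  fixes z :: "real \<times> 'a::euclidean_space"
  assumes "test_factors \<eta> \<eta>1 \<eta>2 F F1 F2" and z: "1 < norm (snd z)"
  shows "time_deriv (radial_test \<eta> F) z = radial_test \<eta>1 F z"
    "time_deriv (time_deriv (radial_test \<eta> F)) z = radial_test \<eta>2 F z"
    "normal_deriv (radial_test \<eta> F) z = radial_test \<eta> F1 z"
    "laplacian (radial_test \<eta> F) z = radial_test \<eta> (\<lambda>r. F2 r + (real DIM('a) - 1) / r * F1 r) z"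
proof -
  have sd: "second_derivs UNIV \<eta> \<eta>1 \<eta>2" "second_derivs {1<..} F F1 F2"
    using assms by (auto simp: test_factors_def)
  have z: "z \<in> exterior" using z by simp
  show "time_deriv (radial_test \<eta> F) z = radial_test \<eta>1 F z" by (rule time_deriv_radial_test[OF sd z])
  show "time_deriv (time_deriv (radial_test \<eta> F)) z = radial_test \<eta>2 F z" by (rule time_deriv2_radial_test[OF sd z])
  show "normal_deriv (radial_test \<eta> F) z = radial_test \<eta> F1 z" by (rule normal_deriv_radial_test[OF sd z])
  show "laplacian (radial_test \<eta> F) z = radial_test \<eta> (\<lambda>r. F2 r + (real DIM('a) - 1) / r * F1 r) z"
    by (rule laplacian_radial_test[OF sd z])
qed

text \<open>What the four weak formulations have in common. The operator \<open>\<alpha>1 * \<partial>\<^sub>t + \<alpha>2 * \<partial>\<^sub>t\<^sub>t\<close> is the adjoint of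
the time part, with \<open>(\<alpha>1, \<alpha>2) = (-1, 0)\<close> for the parabolic and \<open>(0, 1)\<close> for the hyperbolic problem.
The numbers \<open>h\<close> and \<open>h'\<close> prescribe value and slope of the spatial factor at the outer sphere, which
select the Neumann or the Dirichlet class, and \<open>\<beta>\<close> is the resulting multiple of the integral of the
boundary datum.\<close>
definition radial_weak_ineq ::
  "real \<Rightarrow> real \<Rightarrow> real \<Rightarrow> real \<Rightarrow> real \<Rightarrow> real \<Rightarrow> real \<Rightarrow> (real \<times> 'a::euclidean_space \<Rightarrow> real) \<Rightarrow> bool" where
  "radial_weak_ineq \<rho> p \<alpha>1 \<alpha>2 h h' \<beta> u \<longleftrightarrow>
    (\<forall>\<eta> \<eta>1 \<eta>2 F F1 F2. test_factors \<eta> \<eta>1 \<eta>2 F F1 F2 \<longrightarrow> F 2 = h \<longrightarrow> F1 2 = h' \<longrightarrow>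
      cyl_integral \<infinity> (\<lambda>z. source \<rho> p u z * radial_test \<eta> F z) + \<beta> * (LINT t|lborel. \<eta> t)
      \<le> cyl_integral \<infinity> (\<lambda>z. u z * (radial_test (\<lambda>t. \<alpha>1 * \<eta>1 t + \<alpha>2 * \<eta>2 t) F z
            - radial_test \<eta> (\<lambda>r. F2 r + (real DIM('a) - 1) / r * F1 r) z)))"

text \<open>Testing with the \<open>n\<close>-th cutoffs, whose time scale is \<open>n\<close> and whose logarithmic length is \<open>n * ln 2\<close>,
gives \<open>\<beta> * n \<le> C * n powr (- q) * n\<^sup>2\<close>: the bound \<open>k\<close> carries a factor \<open>1 / n\<close>, and the integral
of \<open>dyadic_weight\<close> is of order \<open>n\<^sup>2\<close>. Since the conjugate exponent satisfies \<open>q > 1\<close>, the limit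
\<open>n \<rightarrow> \<infinity>\<close> yields \<open>\<beta> \<le> 0\<close>.\<close>
lemma radial_weak_ineq_imp_nonpos:
  fixes u :: "real \<times> 'a::euclidean_space \<Rightarrow> real"
  assumes p: "p > 1" and \<rho>: "\<rho> = p + 1"
    and u: "Lp_loc p (cylinder \<infinity>) u"
    and prof: "harmonic_profile (real DIM('a)) H H1 H2 M c"
    and weak: "radial_weak_ineq \<rho> p \<alpha>1 \<alpha>2 (H 2) (H1 2) \<beta> u"
  shows "\<beta> \<le> 0"
proof (rule ccontr)
  assume "\<not> \<beta> \<le> 0"
  then have \<beta>: "\<beta> > 0" by simp
  let ?N = "real DIM('a)" and ?Q = "cylinder \<infinity> :: (real \<times> 'a) set"
  have N: "?N \<ge> 1" by (simp add: DIM_positive Suc_leI)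
  have M: "M \<ge> 1" using prof by (simp add: harmonic_profile_def)
  define q where "q = p / (p - 1)"
  have q: "1 / p + 1 / q = 1" "q > 1" using p by (auto simp: q_def field_simps)
  obtain E where E: "E > 0"
    "\<And>n. n \<ge> (1::nat) \<Longrightarrow> \<exists>\<eta> \<eta>1 \<eta>2. second_derivs UNIV \<eta> \<eta>1 \<eta>2 \<and> (\<forall>t. 0 \<le> \<eta> t \<and> \<eta> t \<le> 1) \<and>
       (\<forall>t. t \<notin> {real n..2 * real n} \<longrightarrow> \<eta> t = 0 \<and> \<eta>1 t = 0 \<and> \<eta>2 t = 0) \<and>
       (\<forall>t. \<bar>\<eta>1 t\<bar> \<le> E / real n * \<eta> t powr (1 / p)) \<and> (\<forall>t. \<bar>\<eta>2 t\<bar> \<le> E / real n * \<eta> t powr (1 / p)) \<and>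
       integrable lborel \<eta> \<and> real n / 3 \<le> (LINT t|lborel. \<eta> t)"
    by (rule time_cutoff_exists[OF p], rule that; assumption)
  obtain B where B: "B > 0"
    "\<And>n. n \<ge> (1::nat) \<Longrightarrow> \<exists>F F1 F2. second_derivs {1<..} F F1 F2 \<and> F 2 = H 2 \<and> F1 2 = H1 2 \<and>
       (\<forall>r. 1 < r \<and> r \<le> 2 \<longrightarrow> 0 \<le> F r \<and> F r \<le> M) \<and>
       (\<forall>r. 1 < r \<and> r \<le> 1 + (1/2) ^ Suc n \<longrightarrow> F r = 0 \<and> F1 r = 0 \<and> F2 r = 0) \<and>
       (\<forall>r. 1 < r \<and> r \<le> 2 \<longrightarrow> r - 1 > 1/2 \<longrightarrow> F2 r + (?N - 1) / r * F1 r = 0) \<and>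
       (\<forall>r. 1 < r \<and> r - 1 \<le> 1/2 \<longrightarrow>
          \<bar>F2 r + (?N - 1) / r * F1 r\<bar> \<le> B / real n * F r powr (1 / p) * (r - 1) powr (- 2))"
    by (rule radial_cutoff_exists[OF p N prof], rule that; assumption)
  obtain c0 where c0: "c0 > 0"
    "\<And>n. n \<ge> 1 \<Longrightarrow> set_integrable lebesgue ?Q
        (\<lambda>z. indicator {real n..2 * real n} (fst z) * dyadic_weight n (snd z))"
    "\<And>n. n \<ge> 1 \<Longrightarrow> (LINT z:?Q|lebesgue.
        indicator {real n..2 * real n} (fst z) * dyadic_weight n (snd z)) \<le> c0 * (real n)\<^sup>2"
    by (rule dyadic_weight_integral, rule that; assumption)
  define A where "A = \<bar>\<alpha>1\<bar> + \<bar>\<alpha>2\<bar>"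
  define D where "D = A * E * M + B"
  have A: "A \<ge> 0" by (simp add: A_def)
  have D: "D > 0" unfolding D_def using A E(1) B(1) M by (intro add_nonneg_pos mult_nonneg_nonneg) auto
  have key: "\<beta> * (real n / 3) \<le> (D / real n) powr q * (c0 * (real n)\<^sup>2)" if n: "n \<ge> 1" for n :: nat
  proof -
    obtain \<eta> \<eta>1 \<eta>2 where \<eta>: "second_derivs UNIV \<eta> \<eta>1 \<eta>2" "\<And>t. 0 \<le> \<eta> t" "\<And>t. \<eta> t \<le> 1"
       "\<And>t. t \<notin> {real n..2 * real n} \<Longrightarrow> \<eta> t = 0 \<and> \<eta>1 t = 0 \<and> \<eta>2 t = 0"
       "\<And>t. \<bar>\<eta>1 t\<bar> \<le> E / real n * \<eta> t powr (1 / p)" "\<And>t. \<bar>\<eta>2 t\<bar> \<le> E / real n * \<eta> t powr (1 / p)"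
       "integrable lborel \<eta>" "real n / 3 \<le> (LINT t|lborel. \<eta> t)"
      using E(2)[OF n] by blast
    obtain F F1 F2 where F': "second_derivs {1<..} F F1 F2 \<and> F 2 = H 2 \<and> F1 2 = H1 2 \<and>
       (\<forall>r. 1 < r \<and> r \<le> 2 \<longrightarrow> 0 \<le> F r \<and> F r \<le> M) \<and>
       (\<forall>r. 1 < r \<and> r \<le> 1 + (1/2) ^ Suc n \<longrightarrow> F r = 0 \<and> F1 r = 0 \<and> F2 r = 0) \<and>
       (\<forall>r. 1 < r \<and> r \<le> 2 \<longrightarrow> r - 1 > 1/2 \<longrightarrow> F2 r + (?N - 1) / r * F1 r = 0) \<and>
       (\<forall>r. 1 < r \<and> r - 1 \<le> 1/2 \<longrightarrow>
          \<bar>F2 r + (?N - 1) / r * F1 r\<bar> \<le> B / real n * F r powr (1 / p) * (r - 1) powr (- 2))"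
      using B(2)[OF n] by (elim exE) (rule that)
    have F: "second_derivs {1<..} F F1 F2" "F 2 = H 2" "F1 2 = H1 2"
       "\<And>r. 1 < r \<Longrightarrow> r \<le> 2 \<Longrightarrow> 0 \<le> F r \<and> F r \<le> M"
       "\<And>r. 1 < r \<Longrightarrow> r \<le> 1 + (1/2) ^ Suc n \<Longrightarrow> F r = 0 \<and> F1 r = 0 \<and> F2 r = 0"
       "\<And>r. 1 < r \<Longrightarrow> r \<le> 2 \<Longrightarrow> r - 1 > 1/2 \<Longrightarrow> F2 r + (?N - 1) / r * F1 r = 0"
       "\<And>r. 1 < r \<Longrightarrow> r - 1 \<le> 1/2 \<Longrightarrow>
          \<bar>F2 r + (?N - 1) / r * F1 r\<bar> \<le> B / real n * F r powr (1 / p) * (r - 1) powr (- 2)"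
      using F' by - (elim conjE; blast)+
    define e :: real where "e = (1/2) ^ Suc n"
    have e: "e > 0" by (simp add: e_def)
    have n0: "0 < real n" using n by simp
    have tf: "test_factors \<eta> \<eta>1 \<eta>2 F F1 F2"
      unfolding test_factors_def
    proof (intro conjI allI impI)
      show "\<exists>a b. 0 < a \<and> (\<forall>t. t \<notin> {a..b} \<longrightarrow> \<eta> t = 0 \<and> \<eta>1 t = 0 \<and> \<eta>2 t = 0)"
        using n0 \<eta>(4) by blast
      show "\<exists>e>0. \<forall>r. 1 < r \<and> r \<le> 1 + e \<longrightarrow> F r = 0 \<and> F1 r = 0 \<and> F2 r = 0"
        using F(5) e unfolding e_def by blast
    qed (use \<eta>(1,2,7) F(1,4) in auto)
    define L where "L r = F2 r + (?N - 1) / r * F1 r" for r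
    define d where "d t = \<alpha>1 * \<eta>1 t + \<alpha>2 * \<eta>2 t" for t
    define w where "w r = (r - 1) powr (- \<rho>) * F r" for r
    define g where "g z = radial_test d F z - radial_test \<eta> L z" for z :: "real \<times> 'a"
    define k where "k z = D / real n * (indicator {real n..2 * real n} (fst z) * dyadic_weight n (snd z)) powr (1 / q)"
      for z :: "real \<times> 'a"
    note cont = second_derivs_continuous[OF \<eta>(1)] second_derivs_continuous[OF F(1)]
    have cd: "continuous_on UNIV d" unfolding d_def by (intro continuous_intros cont)
    have cL: "continuous_on {1<..} L" unfolding L_def by (intro continuous_intros cont) auto
    have cw: "continuous_on {1<..} w" unfolding w_def by (intro continuous_intros cont) auto
    have kq: "k z powr q = (D / real n) powr q *
        (indicator {real n..2 * real n} (fst z) * dyadic_weight n (snd z))" for z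
      using D q(2) dyadic_weight_ge_1[of n "snd z"]
      by (auto simp: k_def powr_mult powr_powr indicator_def powr_divide)
    have "\<beta> * (LINT t|lborel. \<eta> t) \<le> (LINT z:?Q|lebesgue. k z powr q)"
    proof (rule boundary_term_le[OF u _ p q(1)])
      show "?Q \<in> sets lebesgue" by (simp add: sets_cylinder)
      show "continuous_on ?Q (radial_test \<eta> w)" by (rule continuous_on_radial_test[OF cont(1) cw])
      show "continuous_on ?Q g"
        unfolding g_def[abs_def] by (intro continuous_on_diff continuous_on_radial_test cont cd cL)
      show "compact (core (real n) (2 * real n) e)" "core (real n) (2 * real n) e \<subseteq> ?Q"
        by (rule compact_core[OF n0 e])+
      show "radial_test \<eta> w z = 0" if "z \<in> ?Q - core (real n) (2 * real n) e" for z
        by (rule radial_test_eq_0_off_core[OF _ _ that]) (use \<eta>(4) F(5) in \<open>auto simp: w_def e_def\<close>)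
      show "g z = 0" if "z \<in> ?Q - core (real n) (2 * real n) e" for z
      proof -
        have "radial_test d F z = 0"
          by (rule radial_test_eq_0_off_core[OF _ _ that]) (use \<eta>(4) F(5) in \<open>auto simp: d_def e_def\<close>)
        moreover have "radial_test \<eta> L z = 0"
          by (rule radial_test_eq_0_off_core[OF _ _ that]) (use \<eta>(4) F(5) in \<open>auto simp: L_def e_def\<close>)
        ultimately show ?thesis by (simp add: g_def)
      qed
      show "set_integrable lebesgue ?Q (\<lambda>z. k z powr q)"
        unfolding kq using c0(2)[OF n] by (intro set_integrable_mult_right) simp
      have src: "source \<rho> p u z * radial_test \<eta> F z = \<bar>u z\<bar> powr p * radial_test \<eta> w z" for z
        by (simp add: source_def radial_test_def w_def)
      have "cyl_integral \<infinity> (\<lambda>z. source \<rho> p u z * radial_test \<eta> F z) + \<beta> * (LINT t|lborel. \<eta> t)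
          \<le> cyl_integral \<infinity> (\<lambda>z. u z * g z)"
        using weak tf F(2,3) unfolding radial_weak_ineq_def g_def L_def[abs_def] d_def[abs_def] by blast
      then show "(LINT z:?Q|lebesgue. \<bar>u z\<bar> powr p * radial_test \<eta> w z) + \<beta> * (LINT t|lborel. \<eta> t)
          \<le> (LINT z:?Q|lebesgue. u z * g z)"
        unfolding src cyl_integral_def .
    next
      fix z :: "real \<times> 'a" assume z: "z \<in> ?Q"
      define r where "r = norm (snd z)"
      define s where "s = r - 1"
      define t where "t = fst z"
      have r: "1 < r" "r \<le> 2" using z by (auto simp: cylinder_infinity shell_def r_def)
      have s: "0 < s" "s \<le> 1" using r by (auto simp: s_def)
      have Fr: "0 \<le> F r" "F r \<le> M" using F(4)[OF r] by auto
      show "radial_test \<eta> w z \<ge> 0"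
        using Fr \<eta>(2) by (simp add: radial_test_def w_def r_def)
      show "k z \<ge> 0" using D by (simp add: k_def)
      show "\<bar>g z\<bar> \<le> radial_test \<eta> w z powr (1 / p) * k z"
      proof (cases "t \<in> {real n..2 * real n}")
        case False
        then have "g z = 0" "k z = 0"
          using \<eta>(4)[OF False] by (simp_all add: g_def k_def radial_test_def d_def t_def)
        then show ?thesis by simp
      next
        case True
        define J where "J = dyadic_weight n (snd z) powr (1 / q)"
        have J1: "J \<ge> 1" unfolding J_def using dyadic_weight_ge_1 q(2) by (intro ge_one_powr_ge_zero) auto
        have kz: "k z = D / real n * J" using True by (simp add: k_def J_def t_def)
        define Y where "Y = radial_test \<eta> w z powr (1 / p)"
        have Y: "Y = \<eta> t powr (1 / p) * ((s powr (- \<rho>)) powr (1 / p) * F r powr (1 / p))"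
          using \<eta>(2) Fr by (simp add: Y_def radial_test_def w_def r_def s_def t_def powr_mult)
        have Y0: "Y \<ge> 0" by (simp add: Y_def)
        \<comment> \<open>The singular weight is at least \<open>1\<close> on the shell, so it can be ignored for the time derivative.\<close>
        have s\<rho>: "1 \<le> s powr (- \<rho>)" using s p \<rho> powr_mono'[of "- \<rho>" 0 s] by simp
        have sp: "1 \<le> (s powr (- \<rho>)) powr (1 / p)" by (rule ge_one_powr_ge_zero[OF s\<rho>]) (use p in simp)
        have \<eta>Y: "\<eta> t powr (1 / p) * F r powr (1 / p) \<le> Y"
          unfolding Y using sp by (intro mult_left_mono) (auto simp: mult_le_cancel_right1)
        have "\<bar>d t\<bar> \<le> A * (E / real n * \<eta> t powr (1 / p))"
        proof -
          have "\<bar>d t\<bar> \<le> \<bar>\<alpha>1\<bar> * \<bar>\<eta>1 t\<bar> + \<bar>\<alpha>2\<bar> * \<bar>\<eta>2 t\<bar>"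
            unfolding d_def by (metis abs_mult abs_triangle_ineq)
          also have "\<dots> \<le> \<bar>\<alpha>1\<bar> * (E / real n * \<eta> t powr (1 / p)) + \<bar>\<alpha>2\<bar> * (E / real n * \<eta> t powr (1 / p))"
            by (intro add_mono mult_left_mono \<eta>) auto
          finally show ?thesis by (simp add: A_def algebra_simps add_divide_distrib)
        qed
        moreover have "F r \<le> M * F r powr (1 / p)"
        proof -
          have "F r = F r powr (1 / q) * F r powr (1 / p)"
            using q(1) Fr by (simp add: add.commute flip: powr_add)
          also have "\<dots> \<le> M powr 1 * F r powr (1 / p)"
          proof (intro mult_right_mono)
            have "F r powr (1 / q) \<le> M powr (1 / q)" using Fr q(2) by (intro powr_mono2) auto
            also have "\<dots> \<le> M powr 1" using M q(2) by (intro powr_mono) auto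
            finally show "F r powr (1 / q) \<le> M powr 1" .
          qed simp
          finally show ?thesis using M by simp
        qed
        ultimately have "\<bar>d t\<bar> * F r \<le> (A * (E / real n * \<eta> t powr (1 / p))) * (M * F r powr (1 / p))"
          using Fr A E(1) by (intro mult_mono) auto
        also have "\<dots> = A * E * M / real n * (\<eta> t powr (1 / p) * F r powr (1 / p))" by simp
        also have "\<dots> \<le> A * E * M / real n * (Y * J)"
          using \<eta>Y A E(1) M J1 Y0 mult_left_mono[OF J1 Y0] by (intro mult_left_mono) auto
        finally have g1: "\<bar>radial_test d F z\<bar> \<le> A * E * M / real n * (Y * J)"
          using Fr by (simp add: radial_test_def abs_mult r_def t_def)
        have g2: "\<bar>radial_test \<eta> L z\<bar> \<le> B / real n * (Y * J)"
        proof (cases "e < s \<and> s \<le> 1/2")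
          case False
          then consider "s \<le> e" | "s > 1/2" by linarith
          then have "L r = 0"
            by cases (use F(5)[of r] F(6)[of r] r in \<open>auto simp: L_def s_def e_def\<close>)
          then show ?thesis using B(1) Y0 J1 by (simp add: radial_test_def flip: r_def)
        next
          case True
          have "1 / s \<le> dyadic_weight n (snd z)"
            unfolding s_def r_def
            by (rule inverse_le_dyadic_weight[OF n]) (use True in \<open>simp_all add: s_def r_def e_def\<close>)
          then have "s powr (- 1) \<le> dyadic_weight n (snd z)"
            using powr_neg_one[OF s(1)] by simp
          then have "(s powr (- 1)) powr (1 / q) \<le> J"
            unfolding J_def using q(2) by (intro powr_mono2) auto
          then have sJ: "s powr (- (1 / q)) \<le> J" by (simp only: powr_powr mult_minus_left mult_1_left)
          \<comment> \<open>This is where the critical relation between \<open>\<rho>\<close> and \<open>p\<close> enters: after the weight has been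
            split off, exactly \<open>(norm x - 1) powr (- 1)\<close> is left once the \<open>q\<close>-th power is taken.\<close>
          have "- 2 = - \<rho> * (1 / p) + - (1 / q)"
          proof -
            have "1 / q = 1 - 1 / p" using q(1) by linarith
            moreover have "\<rho> * (1 / p) = 1 + 1 / p" unfolding \<rho> using p by (simp add: field_simps)
            ultimately show ?thesis by simp
          qed
          then have "s powr (- 2) = s powr (- \<rho> * (1 / p) + - (1 / q))" by (rule arg_cong)
          also have "\<dots> = (s powr (- \<rho>)) powr (1 / p) * s powr (- (1 / q))"
            by (simp only: powr_add powr_powr)
          finally have s2: "s powr (- 2) = (s powr (- \<rho>)) powr (1 / p) * s powr (- (1 / q))" .
          have "\<bar>L r\<bar> \<le> B / real n * F r powr (1 / p) * s powr (- 2)"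
            using F(7)[of r] r True by (simp add: L_def s_def)
          moreover have "\<eta> t \<le> \<eta> t powr (1 / p)" using \<eta>(2,3) p by (intro le_powr_of_le_one) auto
          ultimately have "\<eta> t * \<bar>L r\<bar> \<le> \<eta> t powr (1 / p) * (B / real n * F r powr (1 / p) * s powr (- 2))"
            by (intro mult_mono) auto
          also have "\<dots> = B / real n * (Y * s powr (- (1 / q)))" by (simp add: Y s2)
          also have "\<dots> \<le> B / real n * (Y * J)"
            using B(1) Y0 sJ by (intro mult_left_mono) auto
          finally show ?thesis using \<eta>(2) by (simp add: radial_test_def abs_mult r_def t_def)
        qed
        have "\<bar>g z\<bar> \<le> A * E * M / real n * (Y * J) + B / real n * (Y * J)"
          unfolding g_def using g1 g2 by linarith
        also have "\<dots> = Y * k z" by (simp add: kz D_def algebra_simps add_divide_distrib)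
        finally show ?thesis by (simp add: Y_def)
      qed
    qed
    also have "\<dots> = (D / real n) powr q * (LINT z:?Q|lebesgue.
        indicator {real n..2 * real n} (fst z) * dyadic_weight n (snd z))"
      unfolding kq by simp
    also have "\<dots> \<le> (D / real n) powr q * (c0 * (real n)\<^sup>2)"
      using c0(3)[OF n] by (intro mult_left_mono) auto
    finally have "\<beta> * (LINT t|lborel. \<eta> t) \<le> (D / real n) powr q * (c0 * (real n)\<^sup>2)" .
    moreover have "\<beta> * (real n / 3) \<le> \<beta> * (LINT t|lborel. \<eta> t)"
      using \<eta>(8) \<beta> by (intro mult_left_mono) auto
    ultimately show ?thesis by linarith
  qed
  have key2: "\<beta> \<le> 3 * c0 * D powr q * real n powr (1 - q)" if n: "n \<ge> 1" for n :: nat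
  proof -
    have n0: "0 < real n" using n by simp
    have "(D / real n) powr q * (c0 * (real n)\<^sup>2) = (c0 * D powr q * real n powr (1 - q)) * real n"
      using n0 D by (simp add: powr_divide powr_diff field_simps power2_eq_square)
    with key[OF n] have "(\<beta> / 3) * real n \<le> (c0 * D powr q * real n powr (1 - q)) * real n" by simp
    then have "\<beta> / 3 \<le> c0 * D powr q * real n powr (1 - q)" using n0 by simp
    then show ?thesis by simp
  qed
  have "(\<lambda>n. 3 * c0 * D powr q * real n powr (1 - q)) \<longlonglongrightarrow> 3 * c0 * D powr q * 0"
    using q(2) by (intro tendsto_intros tendsto_neg_powr filterlim_real_sequentially) auto
  then have "\<beta> \<le> 0"
    by (intro tendsto_lowerbound[where f="\<lambda>n. 3 * c0 * D powr q * real n powr (1 - q)"])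
      (use key2 in \<open>auto intro: eventually_sequentiallyI[of 1]\<close>)
  with \<beta> show False by simp
qed

lemma test_factors_integral_split:
  fixes u :: "real \<times> 'a::euclidean_space \<Rightarrow> real"
  assumes tf: "test_factors \<eta> \<eta>1 \<eta>2 F F1 F2" and u: "Lp_loc p (cylinder \<infinity>) u" "p \<ge> 1"
  shows "- cyl_integral \<infinity> (\<lambda>z. u z * time_deriv (radial_test \<eta> F) z)
      - cyl_integral \<infinity> (\<lambda>z. u z * laplacian (radial_test \<eta> F) z)
    = cyl_integral \<infinity> (\<lambda>z. u z * (radial_test (\<lambda>t. - 1 * \<eta>1 t + 0 * \<eta>2 t) F z
        - radial_test \<eta> (\<lambda>r. F2 r + (real DIM('a) - 1) / r * F1 r) z))" (is ?parabolic)
    and "cyl_integral \<infinity> (\<lambda>z. u z * time_deriv (time_deriv (radial_test \<eta> F)) z)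
      - cyl_integral \<infinity> (\<lambda>z. u z * laplacian (radial_test \<eta> F) z)
    = cyl_integral \<infinity> (\<lambda>z. u z * (radial_test (\<lambda>t. 0 * \<eta>1 t + 1 * \<eta>2 t) F z
        - radial_test \<eta> (\<lambda>r. F2 r + (real DIM('a) - 1) / r * F1 r) z))" (is ?hyperbolic)
proof -
  let ?Q = "cylinder \<infinity> :: (real \<times> 'a) set"
  let ?L = "\<lambda>r. F2 r + (real DIM('a) - 1) / r * F1 r"
  obtain a b where a: "0 < a" "\<And>t. t \<notin> {a..b} \<Longrightarrow> \<eta> t = 0 \<and> \<eta>1 t = 0 \<and> \<eta>2 t = 0"
    using tf unfolding test_factors_def by blast
  obtain e where e: "0 < e" "\<And>r. 1 < r \<Longrightarrow> r \<le> 1 + e \<Longrightarrow> F r = 0 \<and> F1 r = 0 \<and> F2 r = 0"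
    using tf unfolding test_factors_def by blast
  have sd: "second_derivs UNIV \<eta> \<eta>1 \<eta>2" "second_derivs {1<..} F F1 F2"
    using tf by (auto simp: test_factors_def)
  note cont = second_derivs_continuous[OF sd(1)] second_derivs_continuous[OF sd(2)]
  have cL: "continuous_on {1<..} ?L" by (intro continuous_intros cont) auto
  have i: "set_integrable lebesgue ?Q (\<lambda>z. u z * radial_test \<eta>' F z)"
    if "\<eta>' = \<eta>1 \<or> \<eta>' = \<eta>2" for \<eta>'
    by (rule radial_test_set_integrable[OF u _ _ a(1) _ e(1), where b=b])
      (use that cont a e in auto)
  have iL: "set_integrable lebesgue ?Q (\<lambda>z. u z * radial_test \<eta> ?L z)"
    by (rule radial_test_set_integrable[OF u _ cL a(1) _ e(1), where b=b])
      (use cont a e in auto)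
  have Q: "?Q \<in> sets lebesgue" by (simp add: sets_cylinder)
  have norm_gt: "1 < norm (snd z)" if "z \<in> ?Q" for z
    using that cylinder_subset_exterior by blast
  have eq: "cyl_integral \<infinity> (\<lambda>z. u z * time_deriv (radial_test \<eta> F) z)
        = (LINT z:?Q|lebesgue. u z * radial_test \<eta>1 F z)"
    "cyl_integral \<infinity> (\<lambda>z. u z * time_deriv (time_deriv (radial_test \<eta> F)) z)
        = (LINT z:?Q|lebesgue. u z * radial_test \<eta>2 F z)"
    "cyl_integral \<infinity> (\<lambda>z. u z * laplacian (radial_test \<eta> F) z)
        = (LINT z:?Q|lebesgue. u z * radial_test \<eta> ?L z)"
    unfolding cyl_integral_def
    by (intro set_lebesgue_integral_cong Q allI impI; simp add: test_factors_derivs[OF tf] norm_gt)+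
  have "(LINT z:?Q|lebesgue. u z * (radial_test (\<lambda>t. - 1 * \<eta>1 t + 0 * \<eta>2 t) F z - radial_test \<eta> ?L z))
      = (LINT z:?Q|lebesgue. (- 1) * (u z * radial_test \<eta>1 F z) - u z * radial_test \<eta> ?L z)"
    by (rule set_lebesgue_integral_cong[OF Q]) (auto simp: radial_test_def algebra_simps)
  also have "\<dots> = (LINT z:?Q|lebesgue. (- 1) * (u z * radial_test \<eta>1 F z)) - (LINT z:?Q|lebesgue. u z * radial_test \<eta> ?L z)"
    by (intro set_integral_diff(2) set_integrable_mult_right i iL) simp
  also have "(LINT z:?Q|lebesgue. (- 1) * (u z * radial_test \<eta>1 F z)) = (- 1) * (LINT z:?Q|lebesgue. u z * radial_test \<eta>1 F z)"
    by (rule set_integral_mult_right)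
  finally show ?parabolic unfolding eq by (simp add: cyl_integral_def)
  have "(LINT z:?Q|lebesgue. u z * (radial_test (\<lambda>t. 0 * \<eta>1 t + 1 * \<eta>2 t) F z - radial_test \<eta> ?L z))
      = (LINT z:?Q|lebesgue. u z * radial_test \<eta>2 F z - u z * radial_test \<eta> ?L z)"
    by (rule set_lebesgue_integral_cong[OF Q]) (auto simp: radial_test_def algebra_simps)
  also have "\<dots> = (LINT z:?Q|lebesgue. u z * radial_test \<eta>2 F z) - (LINT z:?Q|lebesgue. u z * radial_test \<eta> ?L z)"
    by (intro set_integral_diff(2) i iL) simp
  finally show ?hyperbolic unfolding eq by (simp add: cyl_integral_def)
qed

lemma lat_integral_radial:
  fixes f :: "'a::euclidean_space \<Rightarrow> real"
  assumes tf: "test_factors \<eta> \<eta>1 \<eta>2 F F1 F2" and f: "integrable (surface_measure 2) f"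
    and g: "\<And>z. norm (snd z) = 2 \<Longrightarrow> g z = b * \<eta> (fst z)"
  shows "lat_integral \<infinity> (\<lambda>z. f (snd z) * g z) = b * (LINT x|surface_measure 2. f x) * (LINT t|lborel. \<eta> t)"
proof -
  obtain a a' where a: "0 < a" "\<And>t. t \<notin> {a..a'} \<Longrightarrow> \<eta> t = 0"
    using tf unfolding test_factors_def by blast
  have i: "integrable lborel \<eta>" using tf by (simp add: test_factors_def)
  have "lat_integral \<infinity> (\<lambda>z. f (snd z) * g z) = lat_integral \<infinity> (\<lambda>z. f (snd z) * (b * \<eta> (fst z)))"
    unfolding lat_integral_def set_lebesgue_integral_def
    by (rule Bochner_Integration.integral_cong[OF refl]) (use g in \<open>auto simp: lateral_def indicator_def\<close>)
  also have "\<dots> = (LINT t|lborel. b * \<eta> t) * (LINT x|surface_measure 2. f x)"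
    by (rule lat_integral_product) (use i a f in auto)
  finally show ?thesis by simp
qed

lemma neumann_test_radial:
  assumes tf: "test_factors \<eta> \<eta>1 \<eta>2 F F1 F2" and "F1 2 = 0"
  shows "neumann_test \<infinity> (radial_test \<eta> F :: real \<times> 'a::euclidean_space \<Rightarrow> real)"
  unfolding neumann_test_def
proof (intro conjI ballI)
  fix z :: "real \<times> 'a" assume "z \<in> lateral \<infinity>"
  then have "norm (snd z) = 2" by (auto simp: lateral_def)
  then show "normal_deriv (radial_test \<eta> F) z = 0"
    using assms by (simp add: test_factors_derivs[OF tf]) (simp add: radial_test_def)
qed (use C2_compact_radial_test[OF tf] tf in
    \<open>auto simp: test_factors_def radial_test_def cylinder_infinity shell_def\<close>)

lemma dirichlet_test_radial:
  assumes tf: "test_factors \<eta> \<eta>1 \<eta>2 F F1 F2" and "F 2 = 0" "F1 2 \<le> 0"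
  shows "dirichlet_test \<infinity> (radial_test \<eta> F :: real \<times> 'a::euclidean_space \<Rightarrow> real)"
  unfolding dirichlet_test_def
proof (intro conjI ballI)
  have nn: "0 \<le> \<eta> t" for t using tf by (simp add: test_factors_def)
  fix z :: "real \<times> 'a" assume "z \<in> lateral \<infinity>"
  then have "norm (snd z) = 2" by (auto simp: lateral_def)
  then show "normal_deriv (radial_test \<eta> F) z \<le> 0" "radial_test \<eta> F z = 0"
    using assms(2,3) nn[of "fst z"]
    by (simp_all add: test_factors_derivs[OF tf]) (simp_all add: radial_test_def mult_nonneg_nonpos)
qed (use C2_compact_radial_test[OF tf] tf in
    \<open>auto simp: test_factors_def radial_test_def cylinder_infinity shell_def\<close>)

lemma neumann_boundary_integral:
  fixes f :: "'a::euclidean_space \<Rightarrow> real"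
  assumes "test_factors \<eta> \<eta>1 \<eta>2 F F1 F2" "integrable (surface_measure 2) f" "F 2 = 1"
  shows "lat_integral \<infinity> (\<lambda>z. f (snd z) * radial_test \<eta> F z)
    = (LINT x|surface_measure 2. f x) * (LINT t|lborel. \<eta> t)"
  using lat_integral_radial[OF assms(1,2), of "radial_test \<eta> F" 1] assms(3) by (simp add: radial_test_def)

lemma dirichlet_boundary_integral:
  fixes f :: "'a::euclidean_space \<Rightarrow> real"
  assumes "test_factors \<eta> \<eta>1 \<eta>2 F F1 F2" "integrable (surface_measure 2) f"
  shows "lat_integral \<infinity> (\<lambda>z. f (snd z) * normal_deriv (radial_test \<eta> F) z)
    = F1 2 * (LINT x|surface_measure 2. f x) * (LINT t|lborel. \<eta> t)"
  by (rule lat_integral_radial[OF assms])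
    (simp add: test_factors_derivs[OF assms(1)], simp add: radial_test_def)

theorem theorem2p9:
  fixes p \<rho> :: real and f :: "real ^ 'n \<Rightarrow> real"
  assumes "CARD('n) \<ge> 2"
    and "p > 1"
    and "integrable (surface_measure 2) f"
    and "(LINT x|surface_measure 2. f x) > 0"
    and "p = \<rho> - 1"
  shows "((\<nexists>u. parabolic_neumann_sol \<infinity> \<rho> p f u) \<and> (\<nexists>u. parabolic_dirichlet_sol \<infinity> \<rho> p f u)) \<and>
    ((\<nexists>u. hyperbolic_neumann_sol \<infinity> \<rho> p f u) \<and> (\<nexists>u. hyperbolic_dirichlet_sol \<infinity> \<rho> p f u))"
proof -
  let ?I = "LINT x|surface_measure 2. f x"
  have p: "p \<ge> 1" "p > 1" and \<rho>: "\<rho> = p + 1" using assms by auto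
  obtain H H1 H2 M c where prof: "harmonic_profile (real DIM(real ^ 'n)) H H1 H2 M c"
    and H: "H 2 = 0" "H1 2 < 0"
    by (rule Dirichlet_profile_exists[of "real DIM(real ^ 'n)"]) (use assms(1) in auto)
  have neu: False if "Lp_loc p (cylinder \<infinity>) u" "radial_weak_ineq \<rho> p \<alpha>1 \<alpha>2 1 0 ?I u"
    for u :: "real \<times> (real ^ 'n) \<Rightarrow> real" and \<alpha>1 \<alpha>2
    using radial_weak_ineq_imp_nonpos[OF p(2) \<rho> that(1) harmonic_profile_one that(2)] assms(4) by simp
  have dir: False if "Lp_loc p (cylinder \<infinity>) u" "radial_weak_ineq \<rho> p \<alpha>1 \<alpha>2 (H 2) (H1 2) (- (H1 2) * ?I) u"
    for u :: "real \<times> (real ^ 'n) \<Rightarrow> real" and \<alpha>1 \<alpha>2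
    using radial_weak_ineq_imp_nonpos[OF p(2) \<rho> that(1) prof that(2)] assms(4) H(2)
    by (simp add: mult_le_0_iff zero_le_mult_iff)
  have "\<not> parabolic_neumann_sol \<infinity> \<rho> p f u" for u
  proof
    assume sol: "parabolic_neumann_sol \<infinity> \<rho> p f u"
    then have u: "Lp_loc p (cylinder \<infinity>) u" by (simp add: parabolic_neumann_sol_def)
    have "radial_weak_ineq \<rho> p (- 1) 0 1 0 ?I u"
      unfolding radial_weak_ineq_def
    proof (intro allI impI)
      fix \<eta> \<eta>1 \<eta>2 F F1 F2 assume tf: "test_factors \<eta> \<eta>1 \<eta>2 F F1 F2" and F: "F 2 = 1" "F1 2 = 0"
      show "cyl_integral \<infinity> (\<lambda>z. source \<rho> p u z * radial_test \<eta> F z) + ?I * (LINT t|lborel. \<eta> t)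
        \<le> cyl_integral \<infinity> (\<lambda>z. u z * (radial_test (\<lambda>t. - 1 * \<eta>1 t + 0 * \<eta>2 t) F z
            - radial_test \<eta> (\<lambda>r. F2 r + (real DIM(real ^ 'n) - 1) / r * F1 r) z))"
        using sol neumann_test_radial[OF tf F(2), where 'a="real ^ 'n"]
        unfolding parabolic_neumann_sol_def neumann_boundary_integral[OF tf assms(3) F(1), symmetric]
          test_factors_integral_split(1)[OF tf u p(1), symmetric] by blast
    qed
    with u show False by (rule neu)
  qed
  moreover have "\<not> hyperbolic_neumann_sol \<infinity> \<rho> p f u" for u
  proof
    assume sol: "hyperbolic_neumann_sol \<infinity> \<rho> p f u"
    then have u: "Lp_loc p (cylinder \<infinity>) u" by (simp add: hyperbolic_neumann_sol_def)
    have "radial_weak_ineq \<rho> p 0 1 1 0 ?I u"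
      unfolding radial_weak_ineq_def
    proof (intro allI impI)
      fix \<eta> \<eta>1 \<eta>2 F F1 F2 assume tf: "test_factors \<eta> \<eta>1 \<eta>2 F F1 F2" and F: "F 2 = 1" "F1 2 = 0"
      show "cyl_integral \<infinity> (\<lambda>z. source \<rho> p u z * radial_test \<eta> F z) + ?I * (LINT t|lborel. \<eta> t)
        \<le> cyl_integral \<infinity> (\<lambda>z. u z * (radial_test (\<lambda>t. 0 * \<eta>1 t + 1 * \<eta>2 t) F z
            - radial_test \<eta> (\<lambda>r. F2 r + (real DIM(real ^ 'n) - 1) / r * F1 r) z))"
        using sol neumann_test_radial[OF tf F(2), where 'a="real ^ 'n"]
        unfolding hyperbolic_neumann_sol_def neumann_boundary_integral[OF tf assms(3) F(1), symmetric]
          test_factors_integral_split(2)[OF tf u p(1), symmetric] by blast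
    qed
    with u show False by (rule neu)
  qed
  moreover have "\<not> parabolic_dirichlet_sol \<infinity> \<rho> p f u" for u
  proof
    assume sol: "parabolic_dirichlet_sol \<infinity> \<rho> p f u"
    then have u: "Lp_loc p (cylinder \<infinity>) u" by (simp add: parabolic_dirichlet_sol_def)
    have "radial_weak_ineq \<rho> p (- 1) 0 (H 2) (H1 2) (- (H1 2) * ?I) u"
      unfolding radial_weak_ineq_def
    proof (intro allI impI)
      fix \<eta> \<eta>1 \<eta>2 F F1 F2 assume tf: "test_factors \<eta> \<eta>1 \<eta>2 F F1 F2" and F: "F 2 = H 2" "F1 2 = H1 2"
      have "cyl_integral \<infinity> (\<lambda>z. source \<rho> p u z * radial_test \<eta> F z)
          - lat_integral \<infinity> (\<lambda>z. f (snd z) * normal_deriv (radial_test \<eta> F) z)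
        \<le> cyl_integral \<infinity> (\<lambda>z. u z * (radial_test (\<lambda>t. - 1 * \<eta>1 t + 0 * \<eta>2 t) F z
            - radial_test \<eta> (\<lambda>r. F2 r + (real DIM(real ^ 'n) - 1) / r * F1 r) z))"
        using sol dirichlet_test_radial[OF tf, where 'a="real ^ 'n"] F H
        unfolding parabolic_dirichlet_sol_def test_factors_integral_split(1)[OF tf u p(1), symmetric] by auto
      then show "cyl_integral \<infinity> (\<lambda>z. source \<rho> p u z * radial_test \<eta> F z) + - H1 2 * ?I * (LINT t|lborel. \<eta> t)
        \<le> cyl_integral \<infinity> (\<lambda>z. u z * (radial_test (\<lambda>t. - 1 * \<eta>1 t + 0 * \<eta>2 t) F z
            - radial_test \<eta> (\<lambda>r. F2 r + (real DIM(real ^ 'n) - 1) / r * F1 r) z))"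
        unfolding dirichlet_boundary_integral[OF tf assms(3)] F(2) by simp
    qed
    with u show False by (rule dir)
  qed
  moreover have "\<not> hyperbolic_dirichlet_sol \<infinity> \<rho> p f u" for u
  proof
    assume sol: "hyperbolic_dirichlet_sol \<infinity> \<rho> p f u"
    then have u: "Lp_loc p (cylinder \<infinity>) u" by (simp add: hyperbolic_dirichlet_sol_def)
    have "radial_weak_ineq \<rho> p 0 1 (H 2) (H1 2) (- (H1 2) * ?I) u"
      unfolding radial_weak_ineq_def
    proof (intro allI impI)
      fix \<eta> \<eta>1 \<eta>2 F F1 F2 assume tf: "test_factors \<eta> \<eta>1 \<eta>2 F F1 F2" and F: "F 2 = H 2" "F1 2 = H1 2"
      have "cyl_integral \<infinity> (\<lambda>z. source \<rho> p u z * radial_test \<eta> F z)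
          - lat_integral \<infinity> (\<lambda>z. f (snd z) * normal_deriv (radial_test \<eta> F) z)
        \<le> cyl_integral \<infinity> (\<lambda>z. u z * (radial_test (\<lambda>t. 0 * \<eta>1 t + 1 * \<eta>2 t) F z
            - radial_test \<eta> (\<lambda>r. F2 r + (real DIM(real ^ 'n) - 1) / r * F1 r) z))"
        using sol dirichlet_test_radial[OF tf, where 'a="real ^ 'n"] F H
        unfolding hyperbolic_dirichlet_sol_def test_factors_integral_split(2)[OF tf u p(1), symmetric] by auto
      then show "cyl_integral \<infinity> (\<lambda>z. source \<rho> p u z * radial_test \<eta> F z) + - H1 2 * ?I * (LINT t|lborel. \<eta> t)
        \<le> cyl_integral \<infinity> (\<lambda>z. u z * (radial_test (\<lambda>t. 0 * \<eta>1 t + 1 * \<eta>2 t) F z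
            - radial_test \<eta> (\<lambda>r. F2 r + (real DIM(real ^ 'n) - 1) / r * F1 r) z))"
        unfolding dirichlet_boundary_integral[OF tf assms(3)] F(2) by simp
    qed
    with u show False by (rule dir)
  qed
  ultimately show ?thesis by blast
qed

end
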